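(* Let $n\ge2$ and let $x_1,x_2,\dots$ be positive reals. For each integer $k$ with $0<k<n$, let $\Theta_k$ be the continuous-time Markov chain on words of length $n$ over the alphabet $\{1,2,\dots\}$ whose outgoing transitions from a word $u$ are $u\to\sigma_Su$ for all subsets $S\subseteq[n]$ with $|S|=k$, the transition corresponding to $S$ having rate $\prod_{i\in S}x_{u_i}$ (rates of transitions with the same endpoints add). Then, on the set of words with any fixed multiset of letters, the chains $\Theta_k$, $0<k<n$, all have the same stationary distribution.
   Context: Words $u=u_1\cdots u_n$ are considered cyclically: indices are taken modulo $n$, so $u_0=u_n$. For $i\in[n]$, $\sigma_i(u)$ is the word obtained by sorting the letters in positions $i-1$ and $i$: if $u_{i-1}\le u_i$ nothing changes, otherwise these two letters are swapped. $\sigma_j$ and $\sigma_k$ commute whenever $j\not\equiv k\pm1\pmod n$. For a proper subset $S\subsetneq[n]$, $\sigma_S$ is the composition of all $\sigma_j$, $j\in S$, where whenever $j-1,j\in S$ (cyclically), $\sigma_{j-1}$ is applied before $\sigma_j$; equivalently, split $S$ into maximal cyclic runs $j,j+1,\dots,j+m$ (mod $n$) and apply $\sigma_j,\sigma_{j+1},\dots,\sigma_{j+m}$ in this order within each run. For example, for $n=7$, $\sigma_{\{1,2,4,5,7\}}=\sigma_2\sigma_1\sigma_7\sigma_5\sigma_4$ (rightmost applied first). For $k=1$ this is the inhomogeneous multi-type TASEP on a ring. *)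

theory Defs
  imports Complex_Main "HOL-Library.Multiset"
begin

text \<open>Words of length n are lists; position i (1-based, i in {1..n}) holds u ! (i-1).
  Positions are cyclic: the predecessor of position 1 is position n.\<close>

definition cprev :: "nat \<Rightarrow> nat \<Rightarrow> nat" where
  "cprev n i = (if i = 1 then n else i - 1)"

definition sigma :: "nat \<Rightarrow> nat \<Rightarrow> nat list \<Rightarrow> nat list" where
  "sigma n i u = (let a = cprev n i in
      if u ! (a - 1) \<le> u ! (i - 1) then u
      else u[a - 1 := u ! (i - 1), i - 1 := u ! (a - 1)])"

text \<open>sigma_S for a proper subset S of {1..n}: starting right after the least position s
  not in S, go once around the cycle s+1, s+2, ..., s+n-1 (mod n) and apply sigma_j for
  each j in S, in this order (first element applied first).  Since s is not in S, every
  maximal cyclic run j, j+1, ..., j+m of S is traversed in increasing cyclic order, and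
  different runs commute.\<close>
definition sigmaS :: "nat \<Rightarrow> nat set \<Rightarrow> nat list \<Rightarrow> nat list" where
  "sigmaS n S u = (let s = (LEAST j. j \<in> {1..n} \<and> j \<notin> S);
                      ord = filter (\<lambda>j. j \<in> S) (map (\<lambda>t. (s - 1 + t) mod n + 1) [1..<n])
                   in fold (sigma n) ord u)"

definition trans_rate :: "nat \<Rightarrow> (nat \<Rightarrow> real) \<Rightarrow> nat \<Rightarrow> nat list \<Rightarrow> nat list \<Rightarrow> real" where
  "trans_rate n x k u v =
     (\<Sum>S \<in> {S. S \<subseteq> {1..n} \<and> card S = k \<and> sigmaS n S u = v}. \<Prod>i\<in>S. x (u ! (i - 1)))"

definition words_with :: "nat \<Rightarrow> nat multiset \<Rightarrow> nat list set" where
  "words_with n M = {w. length w = n \<and> mset w = M}"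

definition generator :: "nat \<Rightarrow> (nat \<Rightarrow> real) \<Rightarrow> nat \<Rightarrow> nat list set \<Rightarrow> nat list \<Rightarrow> nat list \<Rightarrow> real" where
  "generator n x k W u v =
     (if u = v then - (\<Sum>v' \<in> W - {u}. trans_rate n x k u v') else trans_rate n x k u v)"

definition stationary :: "nat \<Rightarrow> (nat \<Rightarrow> real) \<Rightarrow> nat \<Rightarrow> nat list set \<Rightarrow> (nat list \<Rightarrow> real) \<Rightarrow> bool" where
  "stationary n x k W \<pi> \<longleftrightarrow>
     (\<forall>w\<in>W. \<pi> w \<ge> 0) \<and> (\<Sum>w\<in>W. \<pi> w) = 1 \<and>
     (\<forall>w\<in>W. (\<Sum>v\<in>W. \<pi> v * generator n x k W v w) = 0)"

end

theory Submission
  imports Defs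
begin

text \<open>The exit rate of \<open>\<Theta>\<^sub>k\<close> is the \<open>k\<close>-th elementary symmetric function of the
  rates of the letters, hence constant on the words with a given multiset. Consequently, if the rate
  matrices \<open>P\<^sub>k\<close> commute, then \<open>P\<^sub>l\<close> maps stationary measures of \<open>\<Theta>\<^sub>k\<close> to multiples of
  stationary measures, and uniqueness of the stationary distribution gives the claim. Uniqueness
  holds because the sorted word can be reached from everywhere: cut the circle before position 1 and
  use only sets that avoid position 1 and contain a descent.

  Commutation is a Yang-Baxter argument. Going once around the circle while carrying the letter that
  currently sits on the preceding position writes \<open>\<Sum>\<^sub>k t\<^sup>k P\<^sub>k\<close>, up to a rotation and to the term
  of degree \<open>n\<close>, as a trace of a product of one matrix per site, acting on the carried letter. For two
  parameters \<open>t\<close> and \<open>s\<close> the products of two site matrices in the two orders are intertwined by an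
  invertible matrix \<open>R\<close> on pairs of carried letters, so the two traces agree; comparing coefficients
  of \<open>t\<^sup>k s\<^sup>l\<close> gives \<open>P\<^sub>k P\<^sub>l = P\<^sub>l P\<^sub>k\<close>.\<close>

subsection \<open>Traces of products of kernels\<close>

definition mprod :: "'i set \<Rightarrow> ('i \<Rightarrow> 'i \<Rightarrow> 'a::comm_semiring_1) \<Rightarrow> ('i \<Rightarrow> 'i \<Rightarrow> 'a) \<Rightarrow> 'i \<Rightarrow> 'i \<Rightarrow> 'a" where
  "mprod I A B = (\<lambda>i j. \<Sum>k\<in>I. A i k * B k j)"

definition trace_on :: "'i set \<Rightarrow> ('i \<Rightarrow> 'i \<Rightarrow> 'a::comm_semiring_1) \<Rightarrow> 'a" where
  "trace_on I A = (\<Sum>i\<in>I. A i i)"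

primrec mlist :: "'i set \<Rightarrow> ('i \<Rightarrow> 'i \<Rightarrow> 'a::comm_semiring_1) list \<Rightarrow> 'i \<Rightarrow> 'i \<Rightarrow> 'a" where
  "mlist I [] = (\<lambda>i j. of_bool (i = j))"
| "mlist I (A # As) = mprod I A (mlist I As)"

lemma mprod_assoc: "mprod I (mprod I A B) D = mprod I A (mprod I B D)"
  by (auto simp: mprod_def sum_distrib_left sum_distrib_right mult.assoc fun_eq_iff intro: sum.swap)

lemma mprod_cong:
  assumes "\<And>k. k \<in> I \<Longrightarrow> A i k = A' i k" "\<And>k. k \<in> I \<Longrightarrow> B k j = B' k j"
  shows "mprod I A B i j = mprod I A' B' i j"
  unfolding mprod_def using assms by (auto intro!: sum.cong)

lemma mprod_id_left: "finite I \<Longrightarrow> i \<in> I \<Longrightarrow> mprod I (\<lambda>i j. of_bool (i = j)) A i j = A i j"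
  by (simp add: mprod_def of_bool_def if_distrib[of "\<lambda>z. z * _"] cong: if_cong)

lemma mprod_id_right: "finite I \<Longrightarrow> j \<in> I \<Longrightarrow> mprod I A (\<lambda>i j. of_bool (i = j)) i j = A i j"
  by (simp add: mprod_def of_bool_def if_distrib[of "\<lambda>z. _ * z"] cong: if_cong)

lemma trace_mprod: "trace_on I (mprod I A B) = trace_on I (mprod I B A)"
  unfolding trace_on_def mprod_def by (subst sum.swap) (simp add: mult.commute)

lemma trace_on_cong: "(\<And>i. i \<in> I \<Longrightarrow> A i i = B i i) \<Longrightarrow> trace_on I A = trace_on I B"
  unfolding trace_on_def by simp

lemma mlist_append:
  assumes "finite I" "i \<in> I"
  shows "mlist I (As @ Bs) i j = mprod I (mlist I As) (mlist I Bs) i j"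
  using assms(2)
proof (induction As arbitrary: i)
  case Nil
  then show ?case using assms(1) by (simp add: mprod_id_left)
next
  case (Cons A As)
  have "mlist I ((A # As) @ Bs) i j = mprod I A (mprod I (mlist I As) (mlist I Bs)) i j"
    using Cons.IH by (auto intro: mprod_cong)
  then show ?case by (simp add: mprod_assoc)
qed

lemma trace_mlist_rotate1:
  assumes "finite I"
  shows "trace_on I (mlist I (rotate1 As)) = trace_on I (mlist I As)"
proof (cases As)
  case (Cons A Bs)
  have "trace_on I (mlist I (Bs @ [A])) = trace_on I (mprod I (mlist I Bs) (mlist I [A]))"
    using assms by (intro trace_on_cong mlist_append)
  also have "\<dots> = trace_on I (mprod I (mlist I Bs) A)"
    using assms by (auto intro!: trace_on_cong mprod_cong simp: mprod_id_right)
  finally show ?thesis using Cons by (simp add: trace_mprod)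
qed simp

lemma trace_mlist_rotate:
  assumes "finite I"
  shows "trace_on I (mlist I (rotate m As)) = trace_on I (mlist I As)"
  by (induction m) (simp_all add: trace_mlist_rotate1 assms)

text \<open>One and the same \<open>R\<close> intertwines the factors at every place, so it can be
  moved through the whole product. Cyclicity of the trace then brings it next to \<open>R'\<close>.
  Both inverse relations occur: \<open>R R'\<close> is inserted and \<open>R' R\<close> is
  removed.\<close>

lemma trace_mlist_intertwine:
  assumes fin: "finite I"
    and inter: "\<And>k i j. k < length As \<Longrightarrow> i \<in> I \<Longrightarrow> j \<in> I \<Longrightarrow> mprod I (As ! k) R i j = mprod I R (Bs ! k) i j"
    and len: "length As = length Bs"
    and inv: "\<And>i j. i \<in> I \<Longrightarrow> j \<in> I \<Longrightarrow> mprod I R R' i j = of_bool (i = j)"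
      "\<And>i j. i \<in> I \<Longrightarrow> j \<in> I \<Longrightarrow> mprod I R' R i j = of_bool (i = j)"
  shows "trace_on I (mlist I As) = trace_on I (mlist I Bs)"
proof -
  have *: "mprod I (mlist I As) R i j = mprod I R (mlist I Bs) i j" if "i \<in> I" "j \<in> I" for i j
    using len inter that
  proof (induction As Bs arbitrary: i rule: list_induct2)
    case Nil
    then show ?case using fin by (simp add: mprod_id_left mprod_id_right)
  next
    case (Cons A As B Bs)
    have h: "mprod I A R i j = mprod I R B i j" if "i \<in> I" "j \<in> I" for i j
      using Cons.prems(1)[of 0] that by simp
    have "mprod I (mlist I (A # As)) R i j = mprod I A (mprod I (mlist I As) R) i j"
      by (simp add: mprod_assoc)
    also have "\<dots> = mprod I A (mprod I R (mlist I Bs)) i j"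
    proof (rule mprod_cong)
      fix k assume "k \<in> I"
      moreover have "mprod I (As ! l) R i j = mprod I R (Bs ! l) i j"
        if "l < length As" "i \<in> I" "j \<in> I" for l i j
        using Cons.prems(1)[of "Suc l"] that by simp
      ultimately show "mprod I (mlist I As) R k j = mprod I R (mlist I Bs) k j"
        using Cons.IH Cons.prems by blast
    qed simp
    also have "\<dots> = mprod I (mprod I A R) (mlist I Bs) i j" by (simp add: mprod_assoc)
    also have "\<dots> = mprod I (mprod I R B) (mlist I Bs) i j"
      using h Cons.prems by (rule_tac mprod_cong) auto
    finally show ?case by (simp add: mprod_assoc)
  qed
  have "trace_on I (mlist I As) = trace_on I (mprod I (mlist I As) (mprod I R R'))"
  proof (rule trace_on_cong)
    fix i assume i: "i \<in> I"
    have "mprod I (mlist I As) (mprod I R R') i i = mprod I (mlist I As) (\<lambda>i j. of_bool (i = j)) i i"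
      using inv i by (intro mprod_cong) auto
    then show "mlist I As i i = mprod I (mlist I As) (mprod I R R') i i"
      using fin i by (simp add: mprod_id_right)
  qed
  also have "\<dots> = trace_on I (mprod I (mprod I R (mlist I Bs)) R')"
    unfolding mprod_assoc[symmetric] using * by (rule_tac trace_on_cong, rule_tac mprod_cong) auto
  also have "\<dots> = trace_on I (mprod I (mlist I Bs) (mprod I R' R))"
    unfolding mprod_assoc by (subst trace_mprod) (simp add: mprod_assoc)
  also have "\<dots> = trace_on I (mlist I Bs)"
  proof (rule trace_on_cong)
    fix i assume i: "i \<in> I"
    have "mprod I (mlist I Bs) (mprod I R' R) i i = mprod I (mlist I Bs) (\<lambda>i j. of_bool (i = j)) i i"
      using inv i by (intro mprod_cong) auto
    then show "mprod I (mlist I Bs) (mprod I R' R) i i = mlist I Bs i i"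
      using fin i by (simp add: mprod_id_right)
  qed
  finally show ?thesis .
qed

subsection \<open>Site matrices and the Yang-Baxter relation\<close>

text \<open>\<open>c\<close> is the letter carried from the preceding position and \<open>b\<close> the letter of the current one,
  whose bell rings iff \<open>e\<close>; the first component stays behind, the second one is carried on.\<close>

definition hop :: "bool \<Rightarrow> nat \<Rightarrow> nat \<Rightarrow> nat \<times> nat" where
  "hop e c b = (if e then (min c b, max c b) else (c, b))"

definition hop_mat :: "bool \<Rightarrow> nat \<Rightarrow> nat \<Rightarrow> nat \<Rightarrow> nat \<Rightarrow> real" where
  "hop_mat e b q c c' = of_bool (hop e c b = (q, c'))"

definition site_mat :: "(nat \<Rightarrow> real) \<Rightarrow> real \<Rightarrow> nat \<Rightarrow> nat \<Rightarrow> nat \<Rightarrow> nat \<Rightarrow> real" where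
  "site_mat x t b q c c' = hop_mat False b q c c' + t * x b * hop_mat True b q c c'"

text \<open>A letter left behind belongs to the preceding position, so \<open>v\<close> is the resulting word
  rotated by one: its first entry is the letter at position \<open>n\<close>.\<close>

definition transfer :: "(nat \<Rightarrow> real) \<Rightarrow> nat set \<Rightarrow> real \<Rightarrow> nat list \<Rightarrow> nat list \<Rightarrow> real" where
  "transfer x C t u v = trace_on C (mlist C (map2 (site_mat x t) u v))"

text \<open>Two rows stacked on one site: the letter \<open>v\<close> left behind by the row with
  parameter \<open>t\<close> is the site letter of the row with parameter \<open>s\<close>, and
  \<open>p\<close> is the pair of carried letters.\<close>

definition double_mat :: "(nat \<Rightarrow> real) \<Rightarrow> nat set \<Rightarrow> real \<Rightarrow> real \<Rightarrow> nat \<Rightarrow> nat \<Rightarrow> nat \<times> nat \<Rightarrow> nat \<times> nat \<Rightarrow> real" where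
  "double_mat x C t s b q p p' =
     (\<Sum>v\<in>C. site_mat x t b v (fst p) (fst p') * site_mat x s v q (snd p) (snd p'))"

text \<open>Found by solving the intertwining relation \<open>double_mat_R_mat\<close>, which is linear in \<open>R\<close>,
  among the matrices that preserve the pair of letters up to order.\<close>

definition R_mat :: "(nat \<Rightarrow> real) \<Rightarrow> real \<Rightarrow> real \<Rightarrow> nat \<times> nat \<Rightarrow> nat \<times> nat \<Rightarrow> real" where
  "R_mat x t s p p' = (case p of (c, d) \<Rightarrow>
     if d \<le> c then (1 + s * x c) / (1 + t * x c) * of_bool (p' = (c, d))
     else of_bool (p' = (c, d)) + (s - t) * x c / (1 + t * x d) * of_bool (p' = (d, c)))"

text \<open>This is \<open>R_mat\<close> with \<open>t\<close> and \<open>s\<close>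
  exchanged.\<close>

definition R_inv :: "(nat \<Rightarrow> real) \<Rightarrow> real \<Rightarrow> real \<Rightarrow> nat \<times> nat \<Rightarrow> nat \<times> nat \<Rightarrow> real" where
  "R_inv x t s p p' = (case p of (c, d) \<Rightarrow>
     if d \<le> c then (1 + t * x c) / (1 + s * x c) * of_bool (p' = (c, d))
     else of_bool (p' = (c, d)) - (s - t) * x c / (1 + s * x d) * of_bool (p' = (d, c)))"

lemma sum_of_bool_mult:
  fixes f :: "'i \<Rightarrow> 'a::semiring_1"
  assumes "finite I" "a \<in> I"
  shows "(\<Sum>k\<in>I. of_bool (k = a) * f k) = f a"
  using assms by (simp add: of_bool_def if_distrib[of "\<lambda>z. z * _"] cong: if_cong)

text \<open>For fixed \<open>q\<close> and \<open>c\<close> at most two entries are nonzero. Stated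
  against a test function \<open>F\<close>, this turns matrix products into substitutions.\<close>

lemma sum_site_mat:
  assumes "finite C" "b \<in> C" "c \<in> C"
  shows "(\<Sum>c'\<in>C. site_mat x t b q c c' * F c') =
     of_bool (q = c) * F b + t * x b * of_bool (q = min c b) * F (max c b)"
proof -
  have m: "max c b \<in> C" using assms by (simp add: max_def)
  have "(\<Sum>c'\<in>C. site_mat x t b q c c' * F c') =
     (\<Sum>c'\<in>C. of_bool (c' = b) * (of_bool (q = c) * F c')
       + of_bool (c' = max c b) * (t * x b * of_bool (q = min c b) * F c'))"
    by (intro sum.cong) (auto simp: site_mat_def hop_mat_def hop_def distrib_right)
  then show ?thesis
    by (simp only: sum.distrib sum_of_bool_mult[OF assms(1) m] sum_of_bool_mult[OF assms(1) assms(2)])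
qed

text \<open>The four terms are the choices of ringing bells. If the first bell is silent, the second
  row meets the letter \<open>c\<close>; if it rings, the second row meets
  \<open>min c b\<close>.\<close>

lemma sum_double_mat:
  assumes fin: "finite C" and C: "b \<in> C" "c \<in> C" "d \<in> C"
  shows "(\<Sum>p\<in>C \<times> C. double_mat x C t s b q (c, d) p * F p) =
     of_bool (q = d) * F (b, c) + s * x c * of_bool (q = min d c) * F (b, max d c)
     + t * x b * (of_bool (q = d) * F (max c b, min c b)
        + s * x (min c b) * of_bool (q = min d (min c b)) * F (max c b, max d (min c b)))"
proof -
  \<comment> \<open>The second row, already summed out, when the first row left \<open>v\<close>
    behind and carries \<open>c'\<close> on.\<close>
  define G where "G v c' = of_bool (q = d) * F (c', v) + s * x v * of_bool (q = min d v) * F (c', max d v)" for v c'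
  have m: "min c b \<in> C" using C by (simp add: min_def)
  have "(\<Sum>p\<in>C \<times> C. double_mat x C t s b q (c, d) p * F p)
      = (\<Sum>c'\<in>C. \<Sum>d'\<in>C. \<Sum>v\<in>C. site_mat x t b v c c' * (site_mat x s v q d d' * F (c', d')))"
    unfolding sum.cartesian_product'
    by (simp add: double_mat_def sum_distrib_right mult.assoc)
  also have "\<dots> = (\<Sum>v\<in>C. \<Sum>c'\<in>C. site_mat x t b v c c' * (\<Sum>d'\<in>C. site_mat x s v q d d' * F (c', d')))"
    unfolding sum_distrib_left
    by (subst (2) sum.swap, subst sum.swap, simp)
  also have "\<dots> = (\<Sum>v\<in>C. \<Sum>c'\<in>C. site_mat x t b v c c' * G v c')"
    using fin C by (intro sum.cong refl) (simp add: sum_site_mat G_def)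
  also have "\<dots> = (\<Sum>v\<in>C. of_bool (v = c) * G v b + of_bool (v = min c b) * (t * x b * G v (max c b)))"
    using fin C by (intro sum.cong refl) (simp add: sum_site_mat)
  also have "\<dots> = G c b + t * x b * G (min c b) (max c b)"
    by (simp only: sum.distrib sum_of_bool_mult[OF fin C(2)] sum_of_bool_mult[OF fin m])
  finally show ?thesis by (simp add: G_def algebra_simps)
qed

lemma sum_R_mat:
  assumes "finite C" "c \<in> C" "d \<in> C"
  shows "(\<Sum>p\<in>C \<times> C. R_mat x t s (c, d) p * F p) =
    (if d \<le> c then (1 + s * x c) / (1 + t * x c) * F (c, d)
     else F (c, d) + (s - t) * x c / (1 + t * x d) * F (d, c))"
proof -
  have f: "finite (C \<times> C)" and m: "(c, d) \<in> C \<times> C" "(d, c) \<in> C \<times> C" using assms by auto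
  have "(\<Sum>p\<in>C \<times> C. R_mat x t s (c, d) p * F p) = (\<Sum>p\<in>C \<times> C.
     of_bool (p = (c, d)) * ((if d \<le> c then (1 + s * x c) / (1 + t * x c) else 1) * F p)
   + of_bool (p = (d, c)) * ((if d \<le> c then 0 else (s - t) * x c / (1 + t * x d)) * F p))"
    by (intro sum.cong refl) (auto simp: R_mat_def)
  then show ?thesis
    by (simp only: sum.distrib sum_of_bool_mult[OF f m(1)] sum_of_bool_mult[OF f m(2)]) simp
qed

lemma sum_R_inv:
  assumes "finite C" "c \<in> C" "d \<in> C"
  shows "(\<Sum>p\<in>C \<times> C. R_inv x t s (c, d) p * F p) =
    (if d \<le> c then (1 + t * x c) / (1 + s * x c) * F (c, d)
     else F (c, d) - (s - t) * x c / (1 + s * x d) * F (d, c))"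
proof -
  have f: "finite (C \<times> C)" and m: "(c, d) \<in> C \<times> C" "(d, c) \<in> C \<times> C" using assms by auto
  have "(\<Sum>p\<in>C \<times> C. R_inv x t s (c, d) p * F p) = (\<Sum>p\<in>C \<times> C.
     of_bool (p = (c, d)) * ((if d \<le> c then (1 + t * x c) / (1 + s * x c) else 1) * F p)
   + of_bool (p = (d, c)) * ((if d \<le> c then 0 else - ((s - t) * x c / (1 + s * x d))) * F p))"
    by (intro sum.cong refl) (auto simp: R_inv_def)
  then show ?thesis
    by (simp only: sum.distrib sum_of_bool_mult[OF f m(1)] sum_of_bool_mult[OF f m(2)]) simp
qed

lemma R_mat_R_inv:
  assumes fin: "finite C" and "p \<in> C \<times> C"
    and nz: "\<And>c. c \<in> C \<Longrightarrow> 1 + t * x c \<noteq> 0 \<and> 1 + s * x c \<noteq> 0"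
  shows "mprod (C \<times> C) (R_mat x t s) (R_inv x t s) p p' = of_bool (p = p')"
    and "mprod (C \<times> C) (R_inv x t s) (R_mat x t s) p p' = of_bool (p = p')"
proof -
  obtain c d where p: "p = (c, d)" "c \<in> C" "d \<in> C" using assms(2) by auto
  show "mprod (C \<times> C) (R_mat x t s) (R_inv x t s) p p' = of_bool (p = p')"
    unfolding mprod_def p(1) using p nz[of c] nz[of d] fin
    by (auto simp: sum_R_mat) (auto simp: R_inv_def)
  show "mprod (C \<times> C) (R_inv x t s) (R_mat x t s) p p' = of_bool (p = p')"
    unfolding mprod_def p(1) using p nz[of c] nz[of d] fin
    by (auto simp: sum_R_inv) (auto simp: R_mat_def)
qed

text \<open>The Yang-Baxter relation. Since \<open>R_mat\<close> depends on neither \<open>b\<close>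
  nor \<open>q\<close>, a single intertwiner serves every site of every pair of words.\<close>

lemma double_mat_R_mat:
  assumes fin: "finite C" and C: "b \<in> C" "p \<in> C \<times> C" "p' \<in> C \<times> C"
    and nz: "\<And>c. c \<in> C \<Longrightarrow> 1 + t * x c \<noteq> 0 \<and> 1 + s * x c \<noteq> 0"
  shows "mprod (C \<times> C) (double_mat x C t s b q) (R_mat x t s) p p' =
         mprod (C \<times> C) (R_mat x t s) (double_mat x C s t b q) p p'"
proof -
  obtain c d where p: "p = (c, d)" "c \<in> C" "d \<in> C" using C by auto
  \<comment> \<open>Column \<open>p'\<close> is read as a sum against the indicator of
    \<open>p'\<close>, so that the explicit row formulas apply. \<open>RF\<close> is
    \<open>R_mat\<close> applied to it, \<open>AF\<close> the double matrix with \<open>t\<close>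
    and \<open>s\<close> exchanged.\<close>
  define F where "F r = (of_bool (r = p') :: real)" for r
  have fs: "finite (C \<times> C)" using fin by simp
  define RF where "RF r = (case r of (c, d) \<Rightarrow>
    (if d \<le> c then (1 + s * x c) / (1 + t * x c) * F (c, d)
     else F (c, d) + (s - t) * x c / (1 + t * x d) * F (d, c)))" for r
  have R: "R_mat x t s r p' = RF r" for r
    by (cases r) (simp add: R_mat_def F_def RF_def eq_commute[of p'])
  define AF where "AF c d = of_bool (q = d) * F (b, c) + t * x c * of_bool (q = min d c) * F (b, max d c)
     + s * x b * (of_bool (q = d) * F (max c b, min c b)
        + t * x (min c b) * of_bool (q = min d (min c b)) * F (max c b, max d (min c b)))" for c d
  have A: "double_mat x C s t b q (c, d) p' = AF c d" if "c \<in> C" "d \<in> C" for c d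
  proof -
    have "double_mat x C s t b q (c, d) p' = (\<Sum>r\<in>C \<times> C. double_mat x C s t b q (c, d) r * F r)"
      using sum_of_bool_mult[OF fs C(3), of "double_mat x C s t b q (c, d)"]
      by (simp add: F_def mult.commute)
    then show ?thesis
      using sum_double_mat[OF fin C(1) that, of x s t q F] by (simp add: AF_def)
  qed
  have nzb: "1 + t * x b \<noteq> 0" "1 + t * x c \<noteq> 0" "1 + t * x d \<noteq> 0"
    using nz C p by auto
  have l: "mprod (C \<times> C) (double_mat x C t s b q) (R_mat x t s) p p' =
     of_bool (q = d) * RF (b, c) + s * x c * of_bool (q = min d c) * RF (b, max d c)
     + t * x b * (of_bool (q = d) * RF (max c b, min c b)
        + s * x (min c b) * of_bool (q = min d (min c b)) * RF (max c b, max d (min c b)))"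
    unfolding mprod_def p(1) R by (rule sum_double_mat[OF fin C(1) p(2,3)])
  have r: "mprod (C \<times> C) (R_mat x t s) (double_mat x C s t b q) p p' =
     (if d \<le> c then (1 + s * x c) / (1 + t * x c) * AF c d
     else AF c d + (s - t) * x c / (1 + t * x d) * AF d c)"
    unfolding mprod_def p(1) using p fin by (simp add: sum_R_mat A)
  show ?thesis
    unfolding l r
    \<comment> \<open>In each case the minima, maxima and conditions on \<open>q\<close> are
      resolved; what remains are rational identities, linear in the values of
      \<open>F\<close>.\<close>
    by (cases "q = b"; cases "q = c"; cases "q = d"; cases b c rule: linorder_cases;
        cases c d rule: linorder_cases; cases b d rule: linorder_cases)
       (simp_all add: RF_def AF_def,
        use nzb in \<open>simp_all add: divide_simps, simp_all add: algebra_simps\<close>)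
qed

section \<open>Composition of two transfer matrices\<close>

lemma sum_lists_Suc:
  "(\<Sum>v\<in>{v. set v \<subseteq> C \<and> length v = Suc n}. f v) = (\<Sum>a\<in>C. \<Sum>v\<in>{v. set v \<subseteq> C \<and> length v = n}. f (a # v))"
  unfolding sum.cartesian_product
  by (rule sum.reindex_bij_witness[of _ "\<lambda>(a, v). a # v" "\<lambda>v. (hd v, tl v)"])
     (auto simp: length_Suc_conv)

lemma sum_swap_pairs:
  "(\<Sum>a\<in>A. \<Sum>b\<in>B. \<Sum>k\<in>K. \<Sum>l\<in>L. f a b k l) = (\<Sum>k\<in>K. \<Sum>l\<in>L. \<Sum>a\<in>A. \<Sum>b\<in>B. f a b k l)"
proof -
  have "(\<Sum>p\<in>A \<times> B. \<Sum>q\<in>K \<times> L. f (fst p) (snd p) (fst q) (snd q)) =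
        (\<Sum>q\<in>K \<times> L. \<Sum>p\<in>A \<times> B. f (fst p) (snd p) (fst q) (snd q))"
    by (rule sum.swap)
  then show ?thesis by (simp add: sum.cartesian_product')
qed

text \<open>The middle word is summed out letter by letter, so that two rows merge into one row
  acting on pairs of carried letters.\<close>

lemma sum_mlist_stack:
  assumes "length u = length z"
  shows "(\<Sum>v\<in>{v. set v \<subseteq> C \<and> length v = length u}.
      mlist C (map2 (site_mat x t) u v) c c' * mlist C (map2 (site_mat x s) v z) d d') =
    mlist (C \<times> C) (map2 (double_mat x C t s) u z) (c, d) (c', d')"
  using assms
proof (induction u z arbitrary: c d rule: list_induct2)
  case Nil
  have "{v. v = [] \<and> set v \<subseteq> C} = {[]}" by auto
  then show ?case by auto
next
  case (Cons b u q z)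
  let ?V = "{v. set v \<subseteq> C \<and> length v = length u}"
  let ?f = "\<lambda>v k. mlist C (map2 (site_mat x t) u v) k c'"
  let ?g = "\<lambda>v l. mlist C (map2 (site_mat x s) v z) l d'"
  have "(\<Sum>v\<in>{v. set v \<subseteq> C \<and> length v = length (b # u)}.
      mlist C (map2 (site_mat x t) (b # u) v) c c' * mlist C (map2 (site_mat x s) v (q # z)) d d')
    = (\<Sum>a\<in>C. \<Sum>v\<in>?V. (\<Sum>k\<in>C. site_mat x t b a c k * ?f v k) * (\<Sum>l\<in>C. site_mat x s a q d l * ?g v l))"
    by (simp add: sum_lists_Suc mprod_def)
  also have "\<dots> = (\<Sum>a\<in>C. \<Sum>v\<in>?V. \<Sum>k\<in>C. \<Sum>l\<in>C. site_mat x t b a c k * site_mat x s a q d l * (?f v k * ?g v l))"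
    unfolding sum_product by (simp add: mult_ac)
  also have "\<dots> = (\<Sum>k\<in>C. \<Sum>l\<in>C. \<Sum>a\<in>C. \<Sum>v\<in>?V. site_mat x t b a c k * site_mat x s a q d l * (?f v k * ?g v l))"
    by (rule sum_swap_pairs)
  also have "\<dots> = (\<Sum>k\<in>C. \<Sum>l\<in>C. double_mat x C t s b q (c, d) (k, l) * (\<Sum>v\<in>?V. ?f v k * ?g v l))"
    by (simp add: double_mat_def sum_product)
  also have "\<dots> = (\<Sum>k\<in>C. \<Sum>l\<in>C. double_mat x C t s b q (c, d) (k, l) *
      mlist (C \<times> C) (map2 (double_mat x C t s) u z) (k, l) (c', d'))"
    by (simp add: Cons.IH)
  finally show ?case by (simp add: mprod_def sum.cartesian_product')
qed

lemma sum_transfer: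
  assumes "length u = length z"
  shows "(\<Sum>v\<in>{v. set v \<subseteq> C \<and> length v = length u}. transfer x C t u v * transfer x C s v z) =
    trace_on (C \<times> C) (mlist (C \<times> C) (map2 (double_mat x C t s) u z))"
proof -
  let ?V = "{v. set v \<subseteq> C \<and> length v = length u}"
  have "(\<Sum>v\<in>?V. transfer x C t u v * transfer x C s v z) =
    (\<Sum>v\<in>?V. \<Sum>p\<in>C \<times> C. mlist C (map2 (site_mat x t) u v) (fst p) (fst p)
       * mlist C (map2 (site_mat x s) v z) (snd p) (snd p))"
    unfolding transfer_def trace_on_def by (simp add: sum_product sum.cartesian_product')
  also have "\<dots> = (\<Sum>p\<in>C \<times> C. \<Sum>v\<in>?V. mlist C (map2 (site_mat x t) u v) (fst p) (fst p)
       * mlist C (map2 (site_mat x s) v z) (snd p) (snd p))"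
    by (rule sum.swap)
  also have "\<dots> = (\<Sum>p\<in>C \<times> C. mlist (C \<times> C) (map2 (double_mat x C t s) u z) p p)"
    by (simp add: sum_mlist_stack[OF assms])
  finally show ?thesis unfolding trace_on_def .
qed

text \<open>Both orders are traces over pairs of carried letters, and \<open>R_mat\<close>
  intertwines their factors.\<close>

lemma transfer_commute:
  assumes "finite C" "set u \<subseteq> C" "length u = length z"
    and "\<And>c. c \<in> C \<Longrightarrow> 1 + t * x c \<noteq> 0 \<and> 1 + s * x c \<noteq> 0"
  shows "(\<Sum>v\<in>{v. set v \<subseteq> C \<and> length v = length u}. transfer x C t u v * transfer x C s v z) =
         (\<Sum>v\<in>{v. set v \<subseteq> C \<and> length v = length u}. transfer x C s u v * transfer x C t v z)"
  unfolding sum_transfer[OF assms(3)]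
proof (rule trace_mlist_intertwine)
  show "finite (C \<times> C)" using assms by simp
  fix i j assume ij: "i \<in> C \<times> C" "j \<in> C \<times> C"
  show "mprod (C \<times> C) (R_mat x t s) (R_inv x t s) i j = of_bool (i = j)"
    "mprod (C \<times> C) (R_inv x t s) (R_mat x t s) i j = of_bool (i = j)"
    by (rule R_mat_R_inv[OF assms(1) ij(1) assms(4)]; assumption)+
  fix k assume "k < length (map2 (double_mat x C t s) u z)"
  then have k: "k < length u" "k < length z" by auto
  then have "u ! k \<in> C" using assms(2) by auto
  from double_mat_R_mat[OF assms(1) this ij assms(4)] k
  show "mprod (C \<times> C) (map2 (double_mat x C t s) u z ! k) (R_mat x t s) i j =
        mprod (C \<times> C) (R_mat x t s) (map2 (double_mat x C s t) u z ! k) i j"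
    by simp
qed simp

lemma map2_rotate1:
  "length u = length v \<Longrightarrow> map2 f (rotate1 u) (rotate1 v) = rotate1 (map2 f u v)"
  by (cases u; cases v) auto

text \<open>A transfer step produces the new word only up to a rotation; this invariance allows the
  rotation to be undone when steps are composed.\<close>

lemma transfer_rotate1:
  assumes "finite C" "length u = length v"
  shows "transfer x C t (rotate1 u) (rotate1 v) = transfer x C t u v"
  unfolding transfer_def using assms by (simp add: map2_rotate1 trace_mlist_rotate1)

section \<open>Traces with a prescribed choice of ringing bells\<close>

primrec sweep :: "(bool \<times> nat) list \<Rightarrow> nat \<Rightarrow> nat list" where
  "sweep [] c = [c]"
| "sweep (p # ps) c = fst (hop (fst p) c (snd p)) # sweep ps (snd (hop (fst p) c (snd p)))"

definition hops :: "bool list \<Rightarrow> nat list \<Rightarrow> nat list \<Rightarrow> (nat \<Rightarrow> nat \<Rightarrow> real) list" where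
  "hops es u v = map2 (\<lambda>(e, b) q. hop_mat e b q) (zip es u) v"

lemma hops_Nil [simp]: "hops [] [] [] = []"
  by (simp add: hops_def)

lemma hops_Cons [simp]: "hops (e # es) (b # u) (q # v) = hop_mat e b q # hops es u v"
  by (simp add: hops_def)

lemma hops_rotate1:
  "length es = length u \<Longrightarrow> length u = length v \<Longrightarrow>
     hops (rotate1 es) (rotate1 u) (rotate1 v) = rotate1 (hops es u v)"
  unfolding hops_def by (cases es; cases u; cases v) auto

lemma hops_rotate:
  "length es = length u \<Longrightarrow> length u = length v \<Longrightarrow>
     hops (rotate m es) (rotate m u) (rotate m v) = rotate m (hops es u v)"
  by (induction m) (simp_all add: hops_rotate1)

lemma sum_hop_mat:
  assumes "finite C" "b \<in> C" "c \<in> C"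
  shows "(\<Sum>k\<in>C. hop_mat e b q c k * F k) = of_bool (q = fst (hop e c b)) * F (snd (hop e c b))"
proof -
  have "snd (hop e c b) \<in> C" using assms by (auto simp: hop_def max_def)
  moreover have "(\<Sum>k\<in>C. hop_mat e b q c k * F k) =
      (\<Sum>k\<in>C. of_bool (k = snd (hop e c b)) * (of_bool (q = fst (hop e c b)) * F k))"
    by (intro sum.cong) (auto simp: hop_mat_def)
  ultimately show ?thesis using sum_of_bool_mult assms(1) by metis
qed

lemma mlist_hops:
  assumes "length es = length u" "length u = length v" "finite C" "set u \<subseteq> C" "c \<in> C"
  shows "mlist C (hops es u v) c c' = of_bool (sweep (zip es u) c = v @ [c'])"
  using assms
proof (induction es u v arbitrary: c rule: list_induct3)
  case (Cons e es b u q v)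
  have "snd (hop e c b) \<in> C" using Cons.prems by (auto simp: hop_def max_def)
  then show ?case using Cons by (auto simp: mprod_def sum_hop_mat)
qed auto

text \<open>A silent bell cuts the circle: the arriving letter is left behind as \<open>q\<close>
  and the sweep restarts with the letter \<open>b\<close> of the site. The trace therefore asks the
  sweep to end by carrying \<open>q\<close>.\<close>

lemma trace_hops_Cons:
  assumes "length es = length u" "length u = length v" "finite C" "set u \<subseteq> C" "b \<in> C" "q \<in> C"
  shows "trace_on C (mlist C (hops (False # es) (b # u) (q # v))) = of_bool (sweep (zip es u) b = v @ [q])"
proof -
  have "trace_on C (mlist C (hops (False # es) (b # u) (q # v))) =
     (\<Sum>c\<in>C. of_bool (c = q) * mlist C (hops es u v) b c)"
    using assms by (simp add: trace_on_def mprod_def sum_hop_mat hop_def eq_commute[of q])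
  then show ?thesis using assms by (simp add: sum_of_bool_mult mlist_hops)
qed

lemma rotate_eq_nth_Cons:
  assumes "m < n" "length xs = n"
  obtains ys where "rotate m xs = xs ! m # ys" "length ys = n - 1" "set ys \<subseteq> set xs"
proof -
  have ne: "rotate m xs \<noteq> []" using assms by auto
  have "hd (rotate m xs) = xs ! m" using hd_rotate_conv_nth[of xs m] assms by force
  then have eq: "rotate m xs = xs ! m # tl (rotate m xs)" using ne by (metis hd_Cons_tl)
  have "set (tl (rotate m xs)) \<subseteq> set (rotate m xs)" using ne by (metis list.set_sel(2) subsetI)
  then show thesis using that[OF eq] assms by simp
qed

text \<open>Cyclicity of the trace moves the silent site \<open>m\<close> to the front. The word
  enters as \<open>rotate1 v\<close> because a letter left behind at a site belongs to the preceding
  position.\<close>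

lemma trace_hops:
  assumes len: "length es = n" "length u = n" "length v = n"
    and C: "finite C" "set u \<subseteq> C" "set v \<subseteq> C"
    and m: "m < n" "\<not> es ! m"
  shows "trace_on C (mlist C (hops es u v)) =
    of_bool (sweep (tl (rotate m (zip es u))) (u ! m) = rotate m (rotate1 v))"
proof -
  obtain es' where es: "rotate m es = es ! m # es'" "length es' = n - 1"
    using rotate_eq_nth_Cons[OF m(1) len(1)] by metis
  obtain u' where u: "rotate m u = u ! m # u'" "length u' = n - 1" "set u' \<subseteq> set u"
    using rotate_eq_nth_Cons[OF m(1) len(2)] by metis
  obtain v' where v: "rotate m v = v ! m # v'" "length v' = n - 1" "set v' \<subseteq> set v"
    using rotate_eq_nth_Cons[OF m(1) len(3)] by metis
  have "rotate m (zip es u) = zip (rotate m es) (rotate m u)"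
    using len(1,2) by (simp add: rotate_drop_take drop_zip take_zip)
  then have z: "tl (rotate m (zip es u)) = zip es' u'"
    by (simp add: es u)
  have "rotate m (rotate1 v) = rotate1 (rotate m v)" by (simp add: rotate1_rotate_swap)
  then have v1: "rotate m (rotate1 v) = v' @ [v ! m]" by (simp add: v)
  have "u ! m \<in> C" "v ! m \<in> C" using C len m by auto
  then have "trace_on C (mlist C (hops (False # es') (u ! m # u') (v ! m # v'))) =
      of_bool (sweep (zip es' u') (u ! m) = v' @ [v ! m])"
    using C u(2,3) es(2) v(2) by (intro trace_hops_Cons) auto
  moreover have "trace_on C (mlist C (hops es u v)) = trace_on C (mlist C (hops (rotate m es) (rotate m u) (rotate m v)))"
    using len C by (simp add: hops_rotate trace_mlist_rotate)
  ultimately show ?thesis by (simp add: z v1 es(1) u(1) v(1) m)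
qed

subsection \<open>Coefficients of the transfer matrix\<close>

definition linsort :: "nat \<Rightarrow> nat list \<Rightarrow> nat list" where
  "linsort t w = (if w ! (t - 1) \<le> w ! t then w else w[t - 1 := w ! t, t := w ! (t - 1)])"

lemma linsort_append:
  "linsort (Suc (length pre)) (pre @ c # b # bs) = pre @ min c b # max c b # bs"
  by (auto simp: linsort_def nth_append list_update_append min_def max_def)

text \<open>The prefix \<open>pre\<close> is finished and \<open>c\<close> is the carried letter.
  Sorting leaves the minimum behind and carries the maximum on; a skipped index leaves
  \<open>c\<close> and carries the next letter. These are the two cases of
  \<open>hop\<close>.\<close>

lemma fold_linsort:
  assumes "length es = length bs"
  shows "fold linsort (filter (\<lambda>t. es ! (t - Suc (length pre))) [Suc (length pre)..<Suc (length pre) + length bs])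
           (pre @ c # bs) = pre @ sweep (zip es bs) c"
  using assms
proof (induction es bs arbitrary: pre c rule: list_induct2)
  case (Cons e es b bs)
  define q c' where "q = fst (hop e c b)" and "c' = snd (hop e c b)"
  have iv: "[Suc (length pre)..<Suc (length pre) + length (b # bs)] =
      Suc (length pre) # [Suc (length (pre @ [q]))..<Suc (length (pre @ [q])) + length bs]"
    by (simp add: upt_rec)
  have flt: "filter (\<lambda>t. (e # es) ! (t - Suc (length pre))) [Suc (length (pre @ [q]))..<Suc (length (pre @ [q])) + length bs]
      = filter (\<lambda>t. es ! (t - Suc (length (pre @ [q])))) [Suc (length (pre @ [q]))..<Suc (length (pre @ [q])) + length bs]"
  proof (rule filter_cong[OF refl])
    fix t assume "t \<in> set [Suc (length (pre @ [q]))..<Suc (length (pre @ [q])) + length bs]"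
    then obtain r where "t = Suc (length pre) + Suc r"
      by (auto dest!: le_Suc_ex)
    then show "(e # es) ! (t - Suc (length pre)) = es ! (t - Suc (length (pre @ [q])))" by simp
  qed
  have "fold linsort (filter (\<lambda>t. (e # es) ! (t - Suc (length pre)))
      [Suc (length pre)..<Suc (length pre) + length (b # bs)]) (pre @ c # b # bs)
    = fold linsort (filter (\<lambda>t. es ! (t - Suc (length (pre @ [q]))))
      [Suc (length (pre @ [q]))..<Suc (length (pre @ [q])) + length bs]) ((pre @ [q]) @ c' # bs)"
    unfolding iv filter.simps flt by (simp add: q_def c'_def hop_def linsort_append)
  also have "\<dots> = (pre @ [q]) @ sweep (zip es bs) c'" by (rule Cons.IH)
  finally show ?case by (simp add: q_def c'_def)
qed simp

lemma length_sigma [simp]: "length (sigma n i u) = length u"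
  by (simp add: sigma_def Let_def)

lemma add_mod_inj:
  fixes m i j n :: nat
  assumes "(m + i) mod n = (m + j) mod n" "i < n" "j < n"
  shows "i = j"
proof -
  have "(m mod n + i) mod n = (m mod n + j) mod n" using assms(1) by (simp add: mod_simps)
  moreover have "m mod n < n" using assms(2) by simp
  moreover have "(r + l) mod n = (if r + l < n then r + l else r + l - n)" if "r < n" "l < n" for r l
    using that by (simp add: le_mod_geq)
  ultimately show ?thesis using assms(2,3) by (simp split: if_splits)
qed

lemma rotate_list_update:
  assumes "t < length w"
  shows "rotate m (w[(m + t) mod length w := y]) = (rotate m w)[t := y]"
proof (rule nth_equalityI)
  fix i assume "i < length (rotate m (w[(m + t) mod length w := y]))"
  then have i: "i < length w" by simp
  then have l: "(m + i) mod length w < length w" by (metis mod_less_divisor not_less_zero neq0_conv)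
  show "rotate m (w[(m + t) mod length w := y]) ! i = (rotate m w)[t := y] ! i"
  proof (cases "i = t")
    case False
    then have "(m + t) mod length w \<noteq> (m + i) mod length w"
      using add_mod_inj[of m t "length w" i] assms i by auto
    then show ?thesis using False i by (simp add: nth_rotate)
  qed (use i l in \<open>simp add: nth_rotate\<close>)
qed simp

text \<open>After rotation by \<open>m\<close> the sorted position has index \<open>t\<close>, and
  \<open>1 \<le> t\<close> guarantees that its cyclic predecessor has index \<open>t - 1\<close>, so
  nothing crosses the ends of the rotated list.\<close>

lemma rotate_sigma:
  assumes "length w = n" "1 \<le> t" "t < n"
  shows "rotate m (sigma n ((m + t) mod n + 1) w) = linsort t (rotate m w)"
proof -
  have a: "cprev n ((m + t) mod n + 1) - 1 = (m + (t - 1)) mod n"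
  proof -
    obtain r where r: "t = Suc r" using assms by (cases t) auto
    then show ?thesis using assms by (auto simp: cprev_def mod_Suc)
  qed
  have n: "rotate m w ! t = w ! ((m + t) mod n)" "rotate m w ! (t - 1) = w ! ((m + (t - 1)) mod n)"
    using assms by (auto simp: nth_rotate add.commute)
  have "rotate m (w[(m + (t - 1)) mod n := p, (m + t) mod n := q]) = (rotate m w)[t - 1 := p, t := q]" for p q
    using rotate_list_update[of t "w[(m + (t - 1)) mod n := p]" m q] rotate_list_update[of "t - 1" w m p] assms
    by simp
  then show ?thesis unfolding sigma_def Let_def linsort_def a n by simp
qed

lemma rotate_inj: "rotate m xs = rotate m ys \<Longrightarrow> xs = ys"
proof (induction m)
  case (Suc m)
  then have "rotate1 (rotate m xs) = rotate1 (rotate m ys)" by simp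
  then have "rotate m xs = rotate m ys"
    by (cases "rotate m xs"; cases "rotate m ys") auto
  then show ?case by (rule Suc.IH)
qed simp

definition marks :: "nat \<Rightarrow> nat set \<Rightarrow> bool list" where
  "marks n S = map (\<lambda>i. i \<in> S) [1..<Suc n]"

lemma length_marks [simp]: "length (marks n S) = n"
  by (simp add: marks_def)

lemma nth_marks [simp]: "j < n \<Longrightarrow> marks n S ! j \<longleftrightarrow> Suc j \<in> S"
  by (simp add: marks_def del: upt_Suc)

text \<open>Rotating the starting position \<open>s\<close> to the front turns the cyclic order of
  \<open>sigmaS\<close> into one pass from left to right, with the letter at \<open>s\<close>
  carried first.\<close>

lemma rotate_sigmaS:
  assumes len: "length u = n" and s: "s = (LEAST j. j \<in> {1..n} \<and> j \<notin> S)" "s \<in> {1..n}"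
  shows "rotate (s - 1) (sigmaS n S u) = sweep (tl (rotate (s - 1) (zip (marks n S) u))) (u ! (s - 1))"
proof -
  define m where "m = s - 1"
  have m: "m < n" using s by (auto simp: m_def)
  let ?f = "\<lambda>t. (m + t) mod n + 1"
  have fold: "rotate m (fold (sigma n) (map ?f ts) w) = fold linsort ts (rotate m w)"
    if "set ts \<subseteq> {1..<n}" "length w = n" for ts w
    using that by (induction ts arbitrary: w) (auto simp: rotate_sigma[simplified])
  have "sigmaS n S u = fold (sigma n) (map ?f (filter (\<lambda>t. ?f t \<in> S) [1..<n])) u"
    unfolding sigmaS_def Let_def s(1)[symmetric] m_def[symmetric] filter_map by (simp add: comp_def)
  also have "rotate m \<dots> = fold linsort (filter (\<lambda>t. ?f t \<in> S) [1..<n]) (rotate m u)"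
    using len by (intro fold) auto
  finally have 1: "rotate m (sigmaS n S u) = fold linsort (filter (\<lambda>t. ?f t \<in> S) [1..<n]) (rotate m u)" .
  obtain es where es: "rotate m (marks n S) = marks n S ! m # es" "length es = n - 1"
    using rotate_eq_nth_Cons[OF m length_marks] by metis
  obtain u' where u: "rotate m u = u ! m # u'" "length u' = n - 1"
    using rotate_eq_nth_Cons[OF m len] by metis
  have "rotate m (zip (marks n S) u) = zip (rotate m (marks n S)) (rotate m u)"
    using len by (simp add: rotate_drop_take drop_zip take_zip)
  then have z: "tl (rotate m (zip (marks n S) u)) = zip es u'"
    by (simp add: es u)
  have "filter (\<lambda>t. ?f t \<in> S) [1..<n] = filter (\<lambda>t. es ! (t - 1)) [1..<n]"
  proof (rule filter_cong[OF refl])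
    fix t assume "t \<in> set [1..<n]"
    then have t: "1 \<le> t" "t < n" by auto
    then have "es ! (t - 1) = rotate m (marks n S) ! t" by (simp add: es nth_Cons')
    also have "\<dots> = marks n S ! ((m + t) mod n)" using t by (simp add: nth_rotate add.commute)
    finally show "(?f t \<in> S) = es ! (t - 1)" using t by simp
  qed
  with 1 have "rotate m (sigmaS n S u) = fold linsort (filter (\<lambda>t. es ! (t - 1)) [1..<n]) (u ! m # u')"
    by (simp add: u)
  also have "\<dots> = sweep (zip es u') (u ! m)"
    using fold_linsort[of es u' "[]" "u ! m"] es u m by simp
  finally show ?thesis unfolding z m_def[symmetric] .
qed

section \<open>Expansion over the sets of ringing bells\<close>

text \<open>Each site matrix is a sum of a silent and a ringing term; multiplying out gives one
  summand per choice of bells. The index set has the shape that \<open>sum_lists_Suc\<close>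
  splits.\<close>

lemma mlist_site_mat_expand:
  assumes "length u = length v"
  shows "mlist C (map2 (site_mat x t) u v) c c' =
    (\<Sum>es\<in>{es. set es \<subseteq> UNIV \<and> length es = length u}.
       prod_list (map2 (\<lambda>e b. if e then t * x b else 1) es u) * mlist C (hops es u v) c c')"
  using assms
proof (induction u v arbitrary: c rule: list_induct2)
  case (Cons b u q v)
  let ?E = "{es. set es \<subseteq> (UNIV :: bool set) \<and> length es = length u}"
  let ?w = "\<lambda>es. prod_list (map2 (\<lambda>e b. if e then t * x b else 1) es u)"
  let ?M = "\<lambda>es k. mlist C (hops es u v) k c'"
  have s: "site_mat x t b q c k = (\<Sum>e\<in>UNIV. (if e then t * x b else 1) * hop_mat e b q c k)" for k
    by (simp add: site_mat_def UNIV_bool)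
  have "mlist C (map2 (site_mat x t) (b # u) (q # v)) c c' =
     (\<Sum>k\<in>C. (\<Sum>e\<in>UNIV. (if e then t * x b else 1) * hop_mat e b q c k) * (\<Sum>es\<in>?E. ?w es * ?M es k))"
    using Cons.IH by (simp add: mprod_def s)
  also have "\<dots> = (\<Sum>k\<in>C. \<Sum>e\<in>UNIV. \<Sum>es\<in>?E. (if e then t * x b else 1) * ?w es * (hop_mat e b q c k * ?M es k))"
    unfolding sum_product by (simp only: mult_ac)
  also have "\<dots> = (\<Sum>e\<in>UNIV. \<Sum>es\<in>?E. \<Sum>k\<in>C. (if e then t * x b else 1) * ?w es * (hop_mat e b q c k * ?M es k))"
    by (subst sum.swap, intro sum.cong refl, rule sum.swap)
  also have "\<dots> = (\<Sum>es\<in>{es. set es \<subseteq> UNIV \<and> length es = length (b # u)}.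
       prod_list (map2 (\<lambda>e b. if e then t * x b else 1) es (b # u)) * mlist C (hops es (b # u) (q # v)) c c')"
    unfolding length_Cons sum_lists_Suc by (simp add: mprod_def sum_distrib_left)
  finally show ?case .
next
  case Nil
  then show ?case by simp
qed

text \<open>Only \<open>k < length u\<close> is of interest: \<open>sigmaS\<close> has no meaning for the full set of positions, for
  which the trace counts the letters that can be carried all the way round.\<close>

definition coef :: "(nat \<Rightarrow> real) \<Rightarrow> nat set \<Rightarrow> nat \<Rightarrow> nat list \<Rightarrow> nat list \<Rightarrow> real" where
  "coef x C k u v = (\<Sum>S\<in>{S. S \<subseteq> {1..length u} \<and> card S = k}.
     (\<Prod>i\<in>S. x (u ! (i - 1))) * trace_on C (mlist C (hops (marks (length u) S) u v)))"

lemma prod_list_marks: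
  assumes "length u = n" "S \<subseteq> {1..n}"
  shows "prod_list (map2 (\<lambda>e b. if e then t * x b else 1) (marks n S) u) = t ^ card S * (\<Prod>i\<in>S. x (u ! (i - 1)) :: real)"
proof -
  have "prod_list (map2 (\<lambda>e b. if e then t * x b else 1) (marks n S) u)
      = (\<Prod>j = 0..<n. if Suc j \<in> S then t * x (u ! j) else 1)"
    using assms(1) by (simp add: prod.list_conv_set_nth)
  also have "\<dots> = (\<Prod>i\<in>{1..n}. if i \<in> S then t * x (u ! (i - 1)) else 1)"
    by (rule prod.reindex_bij_witness[of _ "\<lambda>i. i - 1" Suc]) auto
  also have "\<dots> = (\<Prod>i\<in>S. t * x (u ! (i - 1)))"
    using assms(2) by (simp add: prod.inter_restrict[symmetric] Int_absorb1)
  finally show ?thesis by (simp add: prod.distrib)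
qed

text \<open>Choices of bells correspond to subsets of the positions, and grouping these by size
  collects the powers of \<open>t\<close>.\<close>

lemma transfer_coef:
  assumes "length u = n" "length v = n"
  shows "transfer x C t u v = (\<Sum>k\<le>n. t ^ k * coef x C k u v)"
proof -
  let ?g = "\<lambda>S. t ^ card S * ((\<Prod>i\<in>S. x (u ! (i - 1))) * trace_on C (mlist C (hops (marks n S) u v)))"
  let ?w = "\<lambda>es. prod_list (map2 (\<lambda>e b. if e then t * x b else 1) es u)"
  have "transfer x C t u v = (\<Sum>c\<in>C. \<Sum>es\<in>{es. set es \<subseteq> UNIV \<and> length es = length u}.
      ?w es * mlist C (hops es u v) c c)"
    using assms by (simp add: transfer_def trace_on_def mlist_site_mat_expand)
  also have "\<dots> = (\<Sum>es\<in>{es. set es \<subseteq> UNIV \<and> length es = length u}. ?w es * trace_on C (mlist C (hops es u v)))"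
    unfolding trace_on_def sum_distrib_left by (rule sum.swap)
  also have "\<dots> = (\<Sum>S\<in>Pow {1..n}. ?w (marks n S) * trace_on C (mlist C (hops (marks n S) u v)))"
  proof (rule sum.reindex_bij_witness[of _ "marks n" "\<lambda>es. {i \<in> {1..n}. es ! (i - 1)}"])
    fix es :: "bool list" assume "es \<in> {es. set es \<subseteq> UNIV \<and> length es = length u}"
    then have l: "length es = n" using assms by simp
    then show *: "marks n {i \<in> {1..n}. es ! (i - 1)} = es"
      by (intro nth_equalityI) auto
    show "?w (marks n {i \<in> {1..n}. es ! (i - 1)}) * trace_on C (mlist C (hops (marks n {i \<in> {1..n}. es ! (i - 1)}) u v))
       = ?w es * trace_on C (mlist C (hops es u v))" unfolding * ..
  next
    fix S assume "S \<in> Pow {1..n}"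
    then have "S \<subseteq> {1..n}" by simp
    moreover have "marks n S ! (i - 1) \<longleftrightarrow> i \<in> S" if "i \<in> {1..n}" for i
      using that by (cases i) auto
    ultimately show "{i \<in> {1..n}. marks n S ! (i - 1)} = S" by blast
  qed (auto simp: assms)
  also have "\<dots> = (\<Sum>S\<in>Pow {1..n}. ?g S)"
    using assms by (intro sum.cong refl) (simp add: prod_list_marks mult.assoc)
  also have "\<dots> = (\<Sum>k\<le>n. \<Sum>S\<in>{S \<in> Pow {1..n}. card S = k}. ?g S)"
    by (rule sum.group[symmetric]) (auto dest!: card_mono[rotated])
  also have "\<dots> = (\<Sum>k\<le>n. t ^ k * coef x C k u v)"
    using assms by (simp add: coef_def sum_distrib_left)
  finally show ?thesis .
qed

text \<open>As \<open>k < n\<close>, some position lies outside \<open>S\<close>. Cutting the circle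
  there turns both the trace and \<open>sigmaS\<close> into the same sweep.\<close>

lemma coef_trans_rate:
  assumes "length u = n" "length v = n" "finite C" "set u \<subseteq> C" "set v \<subseteq> C" "k < n"
  shows "coef x C k u v = trans_rate n x k u (rotate1 v)"
proof -
  have *: "trace_on C (mlist C (hops (marks n S) u v)) = of_bool (sigmaS n S u = rotate1 v)"
    if S: "S \<subseteq> {1..n}" "card S = k" for S
  proof -
    have "\<exists>j. j \<in> {1..n} \<and> j \<notin> S"
    proof (rule ccontr)
      assume "\<not> ?thesis"
      then have "S = {1..n}" using S by auto
      then show False using S assms by simp
    qed
    \<comment> \<open>The cut is made where \<open>sigmaS\<close> starts.\<close>
    moreover define s where s: "s = (LEAST j. j \<in> {1..n} \<and> j \<notin> S)"
    ultimately have s': "s \<in> {1..n}" "s \<notin> S" by (metis (mono_tags, lifting) LeastI_ex)+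
    then have "trace_on C (mlist C (hops (marks n S) u v)) =
       of_bool (sweep (tl (rotate (s - 1) (zip (marks n S) u))) (u ! (s - 1)) = rotate (s - 1) (rotate1 v))"
      using assms by (intro trace_hops[where n = n]) auto
    also have "\<dots> = of_bool (rotate (s - 1) (sigmaS n S u) = rotate (s - 1) (rotate1 v))"
      using rotate_sigmaS[OF assms(1) s s'(1)] by simp
    also have "\<dots> = of_bool (sigmaS n S u = rotate1 v)"
      using rotate_inj[of "s - 1" "sigmaS n S u" "rotate1 v"] by auto
    finally show ?thesis .
  qed
  have "coef x C k u v = (\<Sum>S\<in>{S. S \<subseteq> {1..n} \<and> card S = k}.
      if sigmaS n S u = rotate1 v then \<Prod>i\<in>S. x (u ! (i - 1)) else 0)"
    unfolding coef_def using assms(1) * by (intro sum.cong) auto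
  also have "\<dots> = (\<Sum>S\<in>{S \<in> {S. S \<subseteq> {1..n} \<and> card S = k}. sigmaS n S u = rotate1 v}. \<Prod>i\<in>S. x (u ! (i - 1)))"
    by (rule sum.inter_filter[symmetric]) (rule finite_subset[of _ "Pow {1..n}"], auto)
  finally show ?thesis by (simp add: trans_rate_def conj_assoc)
qed

text \<open>A polynomial with infinitely many roots vanishes. Positive arguments suffice, and for
  them the denominators \<open>1 + t * x c\<close> of the intertwiner are nonzero.\<close>

lemma coeffs_eqI:
  fixes a b :: "nat \<Rightarrow> real"
  assumes "\<And>t. t > 0 \<Longrightarrow> (\<Sum>k\<le>n. t ^ k * a k) = (\<Sum>k\<le>n. t ^ k * b k)" and "k \<le> n"
  shows "a k = b k"
proof -
  have "{0<..} \<subseteq> {t. (\<Sum>k\<le>n. (a k - b k) * t ^ k) = 0}"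
  proof
    fix t :: real assume "t \<in> {0<..}"
    then have "(\<Sum>k\<le>n. t ^ k * a k) - (\<Sum>k\<le>n. t ^ k * b k) = 0" using assms(1) by simp
    then show "t \<in> {t. (\<Sum>k\<le>n. (a k - b k) * t ^ k) = 0}"
      by (simp add: sum_subtractf[symmetric] algebra_simps)
  qed
  moreover have "infinite {0::real<..}" by (rule infinite_Ioi)
  ultimately have "infinite {t. (\<Sum>k\<le>n. (a k - b k) * t ^ k) = 0}"
    using finite_subset by blast
  then show ?thesis using assms(2) by (auto simp: polyfun_finite_roots)
qed

lemma finite_lists: "finite C \<Longrightarrow> finite {v. set v \<subseteq> C \<and> length v = n}"
  by (rule finite_lists_length_eq)

lemma coef_commute:
  assumes "finite C" "set u \<subseteq> C" "length u = n" "length z = n" "k \<le> n" "l \<le> n"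
    and pos: "\<And>c. c \<in> C \<Longrightarrow> x c > 0"
  shows "(\<Sum>v\<in>{v. set v \<subseteq> C \<and> length v = n}. coef x C k u v * coef x C l v z) =
         (\<Sum>v\<in>{v. set v \<subseteq> C \<and> length v = n}. coef x C l u v * coef x C k v z)"
proof -
  let ?V = "{v. set v \<subseteq> C \<and> length v = n}"
  define c where "c k l = (\<Sum>v\<in>?V. coef x C k u v * coef x C l v z)" for k l
  have expand: "(\<Sum>v\<in>?V. transfer x C t u v * transfer x C s v z) = (\<Sum>k\<le>n. t ^ k * (\<Sum>l\<le>n. s ^ l * c k l))" for t s
  proof -
    have "(\<Sum>v\<in>?V. transfer x C t u v * transfer x C s v z)
        = (\<Sum>v\<in>?V. (\<Sum>k\<le>n. t ^ k * coef x C k u v) * (\<Sum>l\<le>n. s ^ l * coef x C l v z))"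
      using assms by (intro sum.cong refl) (simp add: transfer_coef[of _ n])
    also have "\<dots> = (\<Sum>v\<in>?V. \<Sum>k\<le>n. \<Sum>l\<le>n. t ^ k * (s ^ l * (coef x C k u v * coef x C l v z)))"
      unfolding sum_product by (simp only: mult_ac)
    also have "\<dots> = (\<Sum>k\<le>n. \<Sum>l\<le>n. \<Sum>v\<in>?V. t ^ k * (s ^ l * (coef x C k u v * coef x C l v z)))"
      by (subst sum.swap, intro sum.cong refl, rule sum.swap)
    finally show ?thesis by (simp only: c_def sum_distrib_left)
  qed
  have eq: "(\<Sum>k\<le>n. t ^ k * (\<Sum>l\<le>n. s ^ l * c k l)) = (\<Sum>k\<le>n. t ^ k * (\<Sum>l\<le>n. s ^ l * c l k))"
    if "t > 0" "s > 0" for t s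
  proof -
    have nz: "1 + t * x a \<noteq> 0 \<and> 1 + s * x a \<noteq> 0" if "a \<in> C" for a
    proof -
      have "0 < t * x a" "0 < s * x a" using pos[OF that] \<open>t > 0\<close> \<open>s > 0\<close> by simp_all
      then show ?thesis by linarith
    qed
    have "length u = length z" using assms by simp
    from transfer_commute[OF assms(1,2) this nz]
    have "(\<Sum>v\<in>?V. transfer x C t u v * transfer x C s v z) = (\<Sum>v\<in>?V. transfer x C s u v * transfer x C t v z)"
      unfolding assms(3) .
    then have "(\<Sum>k\<le>n. t ^ k * (\<Sum>l\<le>n. s ^ l * c k l)) = (\<Sum>k\<le>n. s ^ k * (\<Sum>l\<le>n. t ^ l * c k l))"
      unfolding expand .
    also have "\<dots> = (\<Sum>l\<le>n. \<Sum>k\<le>n. t ^ l * (s ^ k * c k l))"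
      unfolding sum_distrib_left by (subst sum.swap) (simp only: mult_ac)
    finally show ?thesis by (simp only: sum_distrib_left)
  qed
  \<comment> \<open>Coefficients are compared first in \<open>t\<close>, for fixed \<open>s\<close>,
    and then in \<open>s\<close>.\<close>
  have "(\<Sum>l\<le>n. s ^ l * c k l) = (\<Sum>l\<le>n. s ^ l * c l k)" if "s > 0" for s
    by (rule coeffs_eqI[where n = n and a = "\<lambda>k. \<Sum>l\<le>n. s ^ l * c k l"
          and b = "\<lambda>k. \<Sum>l\<le>n. s ^ l * c l k"]) (rule eq that assms(5) | assumption)+
  then have "c k l = c l k" using assms(6) by (rule coeffs_eqI)
  then show ?thesis by (simp add: c_def)
qed

lemma coef_rotate1:
  assumes "finite C" "length u = n" "length v = n" "k \<le> n"
  shows "coef x C k (rotate1 u) (rotate1 v) = coef x C k u v"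
proof (rule coeffs_eqI[where n = n])
  show "(\<Sum>k\<le>n. t ^ k * coef x C k (rotate1 u) (rotate1 v)) = (\<Sum>k\<le>n. t ^ k * coef x C k u v)" for t :: real
    using assms by (simp add: transfer_coef[symmetric] transfer_rotate1)
qed (use assms in auto)

subsection \<open>Commuting rate matrices\<close>

lemma words_with_subset: "words_with n M \<subseteq> {v. set v \<subseteq> set_mset M \<and> length v = n}"
  by (auto simp: words_with_def)

lemma finite_words_with: "finite (words_with n M)"
  using words_with_subset finite_lists[of "set_mset M"] finite_subset by (metis finite_set_mset)

lemma sigma_in_words_with:
  assumes "u \<in> words_with n M" "i \<in> {1..n}"
  shows "sigma n i u \<in> words_with n M"
proof -
  have "cprev n i - 1 < n" "i - 1 < n" using assms(2) by (auto simp: cprev_def)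
  then show ?thesis
    using assms(1) mset_swap[of "i - 1" u "cprev n i - 1"] by (auto simp: words_with_def sigma_def Let_def)
qed

lemma sigmaS_in_words_with:
  assumes "u \<in> words_with n M" "S \<subseteq> {1..n}"
  shows "sigmaS n S u \<in> words_with n M"
proof -
  have *: "fold (sigma n) js u \<in> words_with n M" if "set js \<subseteq> {1..n}" for js
    using that assms(1) by (induction js arbitrary: u) (auto simp: sigma_in_words_with)
  show ?thesis unfolding sigmaS_def Let_def by (rule *) (use assms(2) in auto)
qed

lemma finite_card_subsets: "finite {S. S \<subseteq> {1..n::nat} \<and> card S = k \<and> P S}"
  by (rule finite_subset[of _ "Pow {1..n}"]) auto

lemma trans_rate_eq_0:
  assumes "u \<in> words_with n M" "w \<notin> words_with n M"
  shows "trans_rate n x k u w = 0"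
  unfolding trans_rate_def using sigmaS_in_words_with assms by (intro sum.neutral) blast

text \<open>Sets that leave \<open>u\<close> fixed are counted too; this is what makes the value
  depend on the letters alone.\<close>

definition exit_rate :: "(nat \<Rightarrow> real) \<Rightarrow> nat \<Rightarrow> nat list \<Rightarrow> real" where
  "exit_rate x k u = (\<Sum>S\<in>{S. S \<subseteq> {1..length u} \<and> card S = k}. \<Prod>i\<in>S. x (u ! (i - 1)))"

lemma sum_trans_rate:
  assumes "u \<in> words_with n M"
  shows "(\<Sum>w\<in>words_with n M. trans_rate n x k u w) = exit_rate x k u"
proof -
  have "(\<Sum>w\<in>words_with n M. trans_rate n x k u w) = (\<Sum>w\<in>words_with n M.
     \<Sum>S\<in>{S \<in> {S. S \<subseteq> {1..n} \<and> card S = k}. sigmaS n S u = w}. \<Prod>i\<in>S. x (u ! (i - 1)))"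
    by (simp add: trans_rate_def conj_assoc)
  also have "\<dots> = (\<Sum>S\<in>{S. S \<subseteq> {1..n} \<and> card S = k}. \<Prod>i\<in>S. x (u ! (i - 1)))"
    using assms finite_card_subsets[of n k "\<lambda>_. True"]
    by (intro sum.group finite_words_with) (auto simp: sigmaS_in_words_with)
  finally show ?thesis using assms by (simp add: exit_rate_def words_with_def)
qed

text \<open>Expanding the product gives the elementary symmetric functions of the rates, and the
  product only sees the multiset of letters.\<close>

lemma exit_rate_generating:
  "(\<Sum>k\<le>length u. t ^ k * exit_rate x k u) = (\<Prod>b\<in>#mset u. 1 + t * x b)"
proof -
  let ?n = "length u"
  have "(\<Prod>b\<in>#mset u. 1 + t * x b) = prod_list (map (\<lambda>b. t * x b + 1) u)"
    unfolding mset_map[symmetric] prod_mset_prod_list by (simp only: add.commute)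
  also have "\<dots> = (\<Prod>j = 0..<?n. t * x (u ! j) + 1)"
    by (simp add: prod.list_conv_set_nth)
  also have "\<dots> = (\<Prod>i\<in>{1..?n}. t * x (u ! (i - 1)) + 1)"
    by (rule prod.reindex_bij_witness[of _ "\<lambda>i. i - 1" Suc]) auto
  also have "\<dots> = (\<Sum>S\<in>Pow {1..?n}. \<Prod>i\<in>S. t * x (u ! (i - 1)))"
    by (subst prod_add) auto
  also have "\<dots> = (\<Sum>S\<in>Pow {1..?n}. t ^ card S * (\<Prod>i\<in>S. x (u ! (i - 1))))"
    by (simp add: prod.distrib)
  also have "\<dots> = (\<Sum>k\<le>?n. \<Sum>S\<in>{S \<in> Pow {1..?n}. card S = k}. t ^ card S * (\<Prod>i\<in>S. x (u ! (i - 1))))"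
    by (rule sum.group[symmetric]) (auto dest!: card_mono[rotated])
  also have "\<dots> = (\<Sum>k\<le>?n. t ^ k * exit_rate x k u)"
    by (simp add: exit_rate_def sum_distrib_left)
  finally show ?thesis by simp
qed

lemma exit_rate_cong:
  assumes "mset u = mset v" "k \<le> length u"
  shows "exit_rate x k u = exit_rate x k v"
proof (rule coeffs_eqI[where n = "length u"])
  show "(\<Sum>k\<le>length u. t ^ k * exit_rate x k u) = (\<Sum>k\<le>length u. t ^ k * exit_rate x k v)" for t :: real
    using exit_rate_generating[of t x u] exit_rate_generating[of t x v] assms(1) mset_eq_length[OF assms(1)] by simp
qed (use assms in auto)

lemma rotate1_preimage:
  assumes "length z = n"
  obtains z' where "rotate1 z' = z" "length z' = n" "mset z' = mset z" "set z' = set z"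
proof (cases z rule: rev_cases)
  case Nil
  then show ?thesis using that[of "[]"] assms by simp
next
  case (snoc ys y)
  then show ?thesis using that[of "y # ys"] assms by simp
qed

lemma trans_rate_commute:
  assumes uz: "u \<in> words_with n M" "z \<in> words_with n M" and kl: "k < n" "l < n"
    and pos: "\<And>c. c \<in># M \<Longrightarrow> x c > 0"
  shows "(\<Sum>w\<in>words_with n M. trans_rate n x k u w * trans_rate n x l w z) =
         (\<Sum>w\<in>words_with n M. trans_rate n x l u w * trans_rate n x k w z)"
proof -
  let ?C = "set_mset M"
  let ?V = "{v. set v \<subseteq> ?C \<and> length v = n}"
  have u: "length u = n" "set u \<subseteq> ?C" using uz(1) by (auto simp: words_with_def)
  have lz: "length z = n" "set z \<subseteq> ?C" using uz(2) by (auto simp: words_with_def)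
  \<comment> \<open>Each of the two rows shifts the word by one position, so the target is rotated
    back twice, to \<open>y\<close> and then to \<open>z'\<close>.\<close>
  obtain y where y: "rotate1 y = z" "length y = n" "set y \<subseteq> ?C"
    using rotate1_preimage[OF lz(1)] lz(2) by metis
  obtain z' where z': "rotate1 z' = y" "length z' = n" "set z' \<subseteq> ?C"
    using rotate1_preimage[OF y(2)] y(3) by metis
  have *: "(\<Sum>w\<in>words_with n M. trans_rate n x k u w * trans_rate n x l w z) =
      (\<Sum>v\<in>?V. coef x ?C k u v * coef x ?C l v z')" if "k < n" "l < n" for k l
  proof -
    \<comment> \<open>Words with other multiplicities may be added, since the first rate vanishes on
      them.\<close>
    have "(\<Sum>w\<in>words_with n M. trans_rate n x k u w * trans_rate n x l w z)
        = (\<Sum>w\<in>?V. trans_rate n x k u w * trans_rate n x l w z)"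
      using words_with_subset[of n M] trans_rate_eq_0[OF uz(1)]
      by (intro sum.mono_neutral_left finite_lists finite_set_mset) auto
    also have "\<dots> = (\<Sum>v\<in>?V. trans_rate n x k u (rotate1 v) * trans_rate n x l (rotate1 v) z)"
    proof (rule sum.reindex_bij_betw[symmetric])
      show "bij_betw rotate1 ?V ?V"
        unfolding bij_betw_def
      proof
        show "inj_on rotate1 ?V" by (intro inj_onI, rule rotate_inj[of 1]) simp
        show "rotate1 ` ?V = ?V"
        proof
          show "?V \<subseteq> rotate1 ` ?V"
          proof
            fix v assume v: "v \<in> ?V"
            then have "length v = n" by simp
            then obtain v' where "rotate1 v' = v" "length v' = n" "set v' = set v"
              by (rule rotate1_preimage)
            then show "v \<in> rotate1 ` ?V" using v by (intro image_eqI[of _ _ v']) simp_all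
          qed
        qed auto
      qed
    qed
    also have "\<dots> = (\<Sum>v\<in>?V. coef x ?C k u v * coef x ?C l v z')"
    proof (rule sum.cong[OF refl])
      fix v assume v: "v \<in> ?V"
      \<comment> \<open>Rotation invariance undoes the shift of the middle word in the second
        factor.\<close>
      have "trans_rate n x l (rotate1 v) z = coef x ?C l (rotate1 v) y"
        using v y(2,3) that(2) unfolding y(1)[symmetric] by (intro coef_trans_rate[symmetric]) simp_all
      also have "\<dots> = coef x ?C l v z'"
        unfolding z'(1)[symmetric] using v z'(2) less_imp_le[OF that(2)] by (intro coef_rotate1) simp_all
      moreover have "trans_rate n x k u (rotate1 v) = coef x ?C k u v"
        using v u that(1) by (intro coef_trans_rate[symmetric]) simp_all
      ultimately show "trans_rate n x k u (rotate1 v) * trans_rate n x l (rotate1 v) z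
          = coef x ?C k u v * coef x ?C l v z'" by simp
    qed
    finally show ?thesis .
  qed
  show ?thesis
    unfolding *[OF kl] *[OF kl(2,1)] using u z'(2) kl[THEN less_imp_le]
    by (intro coef_commute pos) simp_all
qed

subsection \<open>Uniqueness of the stationary distribution\<close>

text \<open>A left eigenvector equation in which \<open>\<mu>\<close> may be signed, as the
  uniqueness argument is applied to a measure of total mass zero.\<close>

definition balanced :: "'s set \<Rightarrow> ('s \<Rightarrow> 's \<Rightarrow> real) \<Rightarrow> real \<Rightarrow> ('s \<Rightarrow> real) \<Rightarrow> bool" where
  "balanced W P r \<mu> \<longleftrightarrow> (\<forall>w\<in>W. (\<Sum>v\<in>W. \<mu> v * P v w) = r * \<mu> w)"

text \<open>For the positive part the right side is at most the left side at every state. Both have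
  the same total because the rows sum to \<open>r\<close>, so equality holds everywhere.\<close>

lemma balanced_pos_part:
  assumes fin: "finite W" and nonneg: "\<And>v w. v \<in> W \<Longrightarrow> w \<in> W \<Longrightarrow> 0 \<le> P v w"
    and row: "\<And>v. v \<in> W \<Longrightarrow> (\<Sum>w\<in>W. P v w) = r"
    and bal: "balanced W P r \<mu>"
  shows "balanced W P r (\<lambda>w. max (\<mu> w) 0)"
  unfolding balanced_def
proof
  fix w assume w: "w \<in> W"
  let ?p = "\<lambda>w. max (\<mu> w) 0"
  have le: "r * ?p w \<le> (\<Sum>v\<in>W. ?p v * P v w)" if w: "w \<in> W" for w
  proof (cases "\<mu> w \<ge> 0")
    case True
    then have "r * ?p w = (\<Sum>v\<in>W. \<mu> v * P v w)" using bal w by (simp add: balanced_def max_def)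
    also have "\<dots> \<le> (\<Sum>v\<in>W. ?p v * P v w)"
      using nonneg w by (intro sum_mono mult_right_mono) auto
    finally show ?thesis .
  next
    case False
    then have "r * ?p w = 0" by simp
    also have "\<dots> \<le> (\<Sum>v\<in>W. ?p v * P v w)" using nonneg w by (intro sum_nonneg mult_nonneg_nonneg) auto
    finally show ?thesis .
  qed
  have "(\<Sum>w\<in>W. \<Sum>v\<in>W. ?p v * P v w) = (\<Sum>v\<in>W. ?p v * (\<Sum>w\<in>W. P v w))"
    unfolding sum_distrib_left by (rule sum.swap)
  also have "\<dots> = (\<Sum>w\<in>W. r * ?p w)"
    by (intro sum.cong refl) (simp add: row)
  finally show "(\<Sum>v\<in>W. ?p v * P v w) = r * ?p w"
    using sum_mono_inv[of "\<lambda>w. r * ?p w" W "\<lambda>w. \<Sum>v\<in>W. ?p v * P v w", OF _ _ w fin] le by simp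
qed

text \<open>If \<open>\<mu>\<close> took both signs, its positive and negative parts would both be
  positive at the state \<open>w\<^sub>0\<close>, which is impossible. So \<open>\<mu>\<close> has
  one sign, and total mass zero makes it vanish.\<close>

lemma balanced_eq_0:
  assumes fin: "finite W" and nonneg: "\<And>v w. v \<in> W \<Longrightarrow> w \<in> W \<Longrightarrow> 0 \<le> P v w"
    and row: "\<And>v. v \<in> W \<Longrightarrow> (\<Sum>w\<in>W. P v w) = r"
    and root: "\<And>\<nu> v. balanced W P r \<nu> \<Longrightarrow> (\<And>w. w \<in> W \<Longrightarrow> 0 \<le> \<nu> w) \<Longrightarrow> v \<in> W \<Longrightarrow> 0 < \<nu> v \<Longrightarrow> 0 < \<nu> w\<^sub>0"
    and bal: "balanced W P r \<mu>" and sum0: "(\<Sum>w\<in>W. \<mu> w) = 0" and w: "w \<in> W"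
  shows "\<mu> w = 0"
proof -
  have bal': "balanced W P r (\<lambda>w. - \<mu> w)"
    using bal by (simp add: balanced_def sum_negf)
  have pos: "0 < \<mu> w\<^sub>0" if "v \<in> W" "0 < \<mu> v" for v
    using root[OF balanced_pos_part[OF fin nonneg row bal], of v] that by simp
  have neg: "\<mu> w\<^sub>0 < 0" if "v \<in> W" "\<mu> v < 0" for v
    using root[OF balanced_pos_part[OF fin nonneg row bal'], of v] that by simp
  show ?thesis
  proof (cases "\<exists>v\<in>W. 0 < \<mu> v")
    case True
    then have "\<And>v. v \<in> W \<Longrightarrow> 0 \<le> \<mu> v" using pos neg by (metis less_asym not_le)
    then show ?thesis using sum0 fin w by (simp add: sum_nonneg_eq_0_iff)
  next
    case False
    then have "\<And>v. v \<in> W \<Longrightarrow> 0 \<le> - \<mu> v" by (simp add: not_less)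
    moreover have "(\<Sum>w\<in>W. - \<mu> w) = 0" using sum0 by (simp add: sum_negf)
    ultimately show ?thesis using fin w sum_nonneg_eq_0_iff[of W "\<lambda>w. - \<mu> w"] by simp
  qed
qed

section \<open>A potential that increases under sorting\<close>

text \<open>The sum of \<open>i * w ! i\<close> over the indices counted from 0.\<close>

primrec pot :: "nat list \<Rightarrow> nat" where
  "pot [] = 0"
| "pot (a # w) = sum_list w + pot w"

lemma pot_append_mono: "sum_list w = sum_list w' \<Longrightarrow> pot w < pot w' \<Longrightarrow> pot (pre @ w) < pot (pre @ w')"
  by (induction pre) auto

text \<open>Sorting a descent moves the larger letter to the right. Position 1 is excluded: sorting
  across the cut would bring the larger letter to the front.\<close>

lemma pot_sigma:
  assumes "j \<in> {2..length w}"
  shows "sigma (length w) j w = w \<or> pot w < pot (sigma (length w) j w)"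
proof -
  define t where "t = j - 2"
  have t: "Suc t < length w" and j: "j = Suc (Suc t)" using assms by (auto simp: t_def)
  define pre c b bs where "pre = take t w" and "c = w ! t" and "b = w ! Suc t" and "bs = drop (Suc (Suc t)) w"
  have w: "w = pre @ c # b # bs" and l: "length pre = t"
    using t by (simp_all add: pre_def c_def b_def bs_def Cons_nth_drop_Suc)
  have "sigma (length w) j w = linsort (Suc t) w"
    using rotate_sigma[of w "length w" "Suc t" 0] t j by simp
  also have "\<dots> = pre @ min c b # max c b # bs"
    unfolding w l[symmetric] by (rule linsort_append)
  finally show ?thesis
    unfolding w using pot_append_mono[of "c # b # bs" "b # c # bs" pre] by (cases "c \<le> b") auto
qed

text \<open>If the potential is the same at the end, no step changed the word, so every step acted
  on \<open>w\<close> itself.\<close>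

lemma pot_fold_sigma:
  assumes "set js \<subseteq> {2..n}" "length w = n"
  shows "pot w \<le> pot (fold (sigma n) js w) \<and>
    (pot w = pot (fold (sigma n) js w) \<longrightarrow> (\<forall>j\<in>set js. sigma n j w = w))"
  using assms
proof (induction js arbitrary: w)
  case (Cons j js)
  have IH: "pot (sigma n j w) \<le> pot (fold (sigma n) js (sigma n j w)) \<and>
    (pot (sigma n j w) = pot (fold (sigma n) js (sigma n j w)) \<longrightarrow> (\<forall>i\<in>set js. sigma n i (sigma n j w) = sigma n j w))"
    using Cons.prems by (intro Cons.IH) auto
  have "sigma n j w = w \<or> pot w < pot (sigma n j w)"
    using Cons.prems pot_sigma[of j w] by auto
  then show ?case
  proof
    assume "sigma n j w = w"
    then show ?thesis using IH by simp
  next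
    assume "pot w < pot (sigma n j w)"
    then show ?thesis using IH by simp
  qed
qed simp

text \<open>Earlier steps may destroy the descent at \<open>j\<close>, but only by changing the
  word, and then they have already raised the potential.\<close>

lemma pot_sigmaS:
  assumes S: "S \<subseteq> {2..n}" "j \<in> S" and len: "length w = n" and desc: "w ! (j - 1) < w ! (j - 2)"
  shows "pot w < pot (sigmaS n S w)"
proof -
  have j: "2 \<le> j" "j \<le> n" using S by auto
  \<comment> \<open>As position 1 is outside \<open>S\<close>, \<open>sigmaS\<close> starts there
    and visits the positions \<open>2\<close> to \<open>n\<close> in order.\<close>
  have "(LEAST i. i \<in> {1..n} \<and> i \<notin> S) = 1"
    using S j by (intro Least_equality) auto
  then have eq: "sigmaS n S w = fold (sigma n) (filter (\<lambda>i. i \<in> S) (map (\<lambda>t. t mod n + 1) [1..<n])) w"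
    by (simp add: sigmaS_def)
  have "map (\<lambda>t. t mod n + 1) [1..<n] = map Suc [1..<n]" by (intro map_cong) auto
  then have eq: "sigmaS n S w = fold (sigma n) (filter (\<lambda>i. i \<in> S) [2..<Suc n]) w"
    unfolding eq by (simp only: map_Suc_upt numeral_2_eq_2 One_nat_def)
  have "sigma n j w \<noteq> w"
  proof
    assume "sigma n j w = w"
    moreover have "sigma n j w = w[j - 2 := w ! (j - 1), j - 1 := w ! (j - 2)]"
      using j desc by (simp add: sigma_def cprev_def Let_def numeral_2_eq_2)
    moreover have "w[j - 2 := w ! (j - 1), j - 1 := w ! (j - 2)] ! (j - 1) = w ! (j - 2)"
      using j len by (intro nth_list_update_eq) simp
    ultimately have "w ! (j - 1) = w ! (j - 2)" by simp
    then show False using desc by simp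
  qed
  moreover have "j \<in> set (filter (\<lambda>i. i \<in> S) [2..<Suc n])" using S j by (simp add: less_Suc_eq_le del: upt_Suc)
  moreover have "set (filter (\<lambda>i. i \<in> S) [2..<Suc n]) \<subseteq> {2..n}" by auto
  ultimately show ?thesis
    using pot_fold_sigma[OF _ len] unfolding eq by (metis le_neq_implies_less)
qed

lemma nth_words_with:
  assumes "v \<in> words_with n M" "i \<in> {1..n}"
  shows "v ! (i - 1) \<in># M"
proof -
  have "i - 1 < n" using assms(2) by (cases i) auto
  then show ?thesis using assms(1) by (auto simp: words_with_def)
qed

lemma trans_rate_nonneg:
  assumes "v \<in> words_with n M" and pos: "\<And>c. c \<in># M \<Longrightarrow> x c > 0"
  shows "0 \<le> trans_rate n x k v w"
  unfolding trans_rate_def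
proof (intro sum_nonneg prod_nonneg ballI)
  fix S i assume "S \<in> {S. S \<subseteq> {1..n} \<and> card S = k \<and> sigmaS n S v = w}" "i \<in> S"
  then show "0 \<le> x (v ! (i - 1))"
    using pos[OF nth_words_with[OF assms(1), of i]] by (auto intro: less_imp_le)
qed

lemma trans_rate_pos:
  assumes v: "v \<in> words_with n M" and pos: "\<And>c. c \<in># M \<Longrightarrow> x c > 0" and S: "S \<subseteq> {1..n}"
  shows "0 < trans_rate n x (card S) v (sigmaS n S v)"
proof -
  have p: "0 < (\<Prod>i\<in>T. x (v ! (i - 1)))" if "T \<subseteq> {1..n}" for T
  proof (intro prod_pos ballI)
    fix i assume "i \<in> T"
    then show "0 < x (v ! (i - 1))"
      using pos[OF nth_words_with[OF v, of i]] that by blast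
  qed
  show ?thesis
    unfolding trans_rate_def
    by (rule sum_pos2[OF finite_card_subsets, where i = S]) (use S p in \<open>auto intro: less_imp_le\<close>)
qed

text \<open>Among the words of positive mass take one of maximal potential. If it had a descent,
  some set of size \<open>k\<close> would send mass to a word of larger potential.\<close>

lemma sorted_word_pos:
  assumes bal: "balanced (words_with n M) (trans_rate n x k) r \<nu>"
    and nonneg: "\<And>w. w \<in> words_with n M \<Longrightarrow> 0 \<le> \<nu> w"
    and v: "v \<in> words_with n M" "0 < \<nu> v"
    and k: "0 < k" "k < n" and pos: "\<And>c. c \<in># M \<Longrightarrow> x c > 0"
  shows "0 < \<nu> (sorted_list_of_multiset M)"
proof -
  let ?W = "words_with n M"
  have "\<exists>u. (u \<in> ?W \<and> 0 < \<nu> u) \<and> (\<forall>w. w \<in> ?W \<and> 0 < \<nu> w \<longrightarrow> pot w \<le> pot u)"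
    using v finite_words_with[of n M]
    by (intro ex_has_greatest_nat[where b = "Suc (Max (pot ` ?W))"]) (auto simp: less_Suc_eq_le)
  then obtain u where u: "u \<in> ?W" "0 < \<nu> u" and mx: "\<And>w. w \<in> ?W \<Longrightarrow> 0 < \<nu> w \<Longrightarrow> pot w \<le> pot u"
    by blast
  have nn: "0 \<le> trans_rate n x k v w" if "v \<in> ?W" for v w
    using that pos by (rule trans_rate_nonneg)
  have len: "length u = n" using u by (simp add: words_with_def)
  have "sorted u"
  proof (rule ccontr)
    assume "\<not> sorted u"
    then obtain i where i: "Suc i < n" "u ! Suc i < u ! i"
      using len by (auto simp: sorted_iff_nth_Suc not_le)
    \<comment> \<open>Position \<open>i + 2\<close>, counted from 1, holds the smaller letter of the
      descent. Beside it and position 1 there are \<open>n - 2\<close> positions, enough to fill up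
      a set of size \<open>k\<close>.\<close>
    have "k - 1 \<le> card ({2..n} - {i + 2})" using i k by simp
    then obtain T where T: "T \<subseteq> {2..n} - {i + 2}" "card T = k - 1" "finite T"
      by (rule obtain_subset_with_card_n)
    define S where "S = insert (i + 2) T"
    have "i + 2 \<notin> T" using T(1) by blast
    then have S: "S \<subseteq> {2..n}" "i + 2 \<in> S" "card S = k" using T i k by (auto simp: S_def)
    then have S1: "S \<subseteq> {1..n}" by auto
    let ?w = "sigmaS n S u"
    have w: "?w \<in> ?W" using u(1) S1 by (rule sigmaS_in_words_with)
    have "0 < \<nu> u * trans_rate n x k u ?w"
      using u trans_rate_pos[OF u(1) pos S1] S by simp
    also have "\<dots> \<le> (\<Sum>v\<in>?W. \<nu> v * trans_rate n x k v ?w)"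
      by (rule member_le_sum[where f = "\<lambda>v. \<nu> v * trans_rate n x k v ?w"])
         (use u(1) nonneg nn finite_words_with in \<open>simp_all\<close>)
    also have "\<dots> = r * \<nu> ?w" using bal w by (simp add: balanced_def)
    finally have "0 < \<nu> ?w" using nonneg[OF w] by (metis less_irrefl mult_zero_right order_le_less)
    moreover have "pot u < pot ?w" using pot_sigmaS[OF S(1,2) len] i by simp
    ultimately show False using mx[OF w] by simp
  qed
  then have "sorted_list_of_multiset M = u"
    using u by (auto simp: words_with_def sorted_sort_id)
  then show ?thesis using u by simp
qed

text \<open>The diagonal of \<open>trans_rate\<close> collects the sets that fix a word. Since each
  row sums to \<open>r\<close>, the generator is \<open>trans_rate\<close> minus \<open>r\<close>
  times the identity.\<close>

lemma stationary_iff_balanced: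
  assumes r: "\<And>v. v \<in> words_with n M \<Longrightarrow> exit_rate x k v = r"
  shows "stationary n x k (words_with n M) \<pi> \<longleftrightarrow>
    (\<forall>w\<in>words_with n M. \<pi> w \<ge> 0) \<and> (\<Sum>w\<in>words_with n M. \<pi> w) = 1 \<and>
    balanced (words_with n M) (trans_rate n x k) r \<pi>"
proof -
  let ?W = "words_with n M"
  have gen: "generator n x k ?W v w = trans_rate n x k v w - of_bool (v = w) * r" if "v \<in> ?W" for v w
  proof -
    have "(\<Sum>v'\<in>?W - {v}. trans_rate n x k v v') = r - trans_rate n x k v v"
      using sum_trans_rate[OF that, of x k] r[OF that] that finite_words_with[of n M]
      by (simp add: sum_diff1)
    then show ?thesis by (auto simp: generator_def)
  qed
  have "(\<Sum>v\<in>?W. \<pi> v * generator n x k ?W v w) = (\<Sum>v\<in>?W. \<pi> v * trans_rate n x k v w) - r * \<pi> w"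
    if "w \<in> ?W" for w
  proof -
    have "(\<Sum>v\<in>?W. \<pi> v * generator n x k ?W v w)
      = (\<Sum>v\<in>?W. \<pi> v * trans_rate n x k v w) - (\<Sum>v\<in>?W. of_bool (v = w) * (r * \<pi> v))"
      unfolding sum_subtractf[symmetric] by (intro sum.cong refl) (simp add: gen algebra_simps)
    then show ?thesis by (simp only: sum_of_bool_mult[OF finite_words_with that])
  qed
  then show ?thesis by (simp add: stationary_def balanced_def)
qed

theorem theorem3:
  fixes n :: nat and x :: "nat \<Rightarrow> real" and M :: "nat multiset"
  assumes "n \<ge> 2"
    and "\<And>a. a \<ge> 1 \<Longrightarrow> x a > 0"
    and "\<forall>a \<in># M. a \<ge> 1"
    and "size M = n"
  shows "\<forall>k k' \<pi>. 0 < k \<and> k < n \<and> 0 < k' \<and> k' < n \<and>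
            stationary n x k (words_with n M) \<pi> \<longrightarrow> stationary n x k' (words_with n M) \<pi>"
proof (intro allI impI)
  fix k l \<pi>
  let ?W = "words_with n M"
  let ?P = "trans_rate n x"
  assume A: "0 < k \<and> k < n \<and> 0 < l \<and> l < n \<and> stationary n x k ?W \<pi>"
  then have kl: "0 < k" "k < n" "l < n" by auto
  have pos: "x c > 0" if "c \<in># M" for c using assms(2,3) that by simp
  define E where "E k = exit_rate x k (sorted_list_of_multiset M)" for k
  have E: "exit_rate x k v = E k" if "k < n" "v \<in> ?W" for k v
    unfolding E_def using that by (intro exit_rate_cong) (auto simp: words_with_def)
  have row: "(\<Sum>w\<in>?W. ?P k v w) = E k" if "k < n" "v \<in> ?W" for k v
    using that by (simp add: sum_trans_rate E)
  have stat: "stationary n x i ?W \<pi> \<longleftrightarrow> (\<forall>w\<in>?W. \<pi> w \<ge> 0) \<and> (\<Sum>w\<in>?W. \<pi> w) = 1 \<and> balanced ?W (?P i) (E i) \<pi>"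
    if "i < n" for i
    using E that by (intro stationary_iff_balanced)
  have st: "\<forall>w\<in>?W. \<pi> w \<ge> 0" "(\<Sum>w\<in>?W. \<pi> w) = 1" "balanced ?W (?P k) (E k) \<pi>"
    using A stat[OF kl(2)] by simp_all
  \<comment> \<open>The defect of \<open>\<pi>\<close> as a stationary measure for \<open>l\<close>;
    it is to be shown to vanish.\<close>
  define \<mu> where "\<mu> w = (\<Sum>v\<in>?W. \<pi> v * ?P l v w) - E l * \<pi> w" for w
  have "(\<Sum>w\<in>?W. \<Sum>v\<in>?W. \<pi> v * ?P l v w) = (\<Sum>v\<in>?W. \<pi> v * (\<Sum>w\<in>?W. ?P l v w))"
    unfolding sum_distrib_left by (rule sum.swap)
  also have "\<dots> = (\<Sum>v\<in>?W. E l * \<pi> v)"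
    using kl by (intro sum.cong refl) (simp add: row)
  finally have sum0: "(\<Sum>w\<in>?W. \<mu> w) = 0"
    by (simp add: \<mu>_def sum_subtractf)
  \<comment> \<open>The image of \<open>\<pi>\<close> under \<open>?P l\<close> satisfies the same
    eigenvector equation for \<open>?P k\<close> as \<open>\<pi>\<close>, because the matrices
    commute; hence so does the defect.\<close>
  have bal: "balanced ?W (?P k) (E k) \<mu>"
    unfolding balanced_def
  proof
    fix z assume z: "z \<in> ?W"
    have b: "(\<Sum>v\<in>?W. \<pi> v * ?P k v w) = E k * \<pi> w" if "w \<in> ?W" for w
      using st(3) that by (simp add: balanced_def)
    have assoc: "(\<Sum>w\<in>?W. (\<Sum>v\<in>?W. \<pi> v * ?P i v w) * ?P j w z) = (\<Sum>v\<in>?W. \<pi> v * (\<Sum>w\<in>?W. ?P i v w * ?P j w z))" for i j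
      unfolding sum_distrib_left sum_distrib_right mult.assoc by (rule sum.swap)
    have "(\<Sum>w\<in>?W. (\<Sum>v\<in>?W. \<pi> v * ?P l v w) * ?P k w z) = (\<Sum>w\<in>?W. (\<Sum>v\<in>?W. \<pi> v * ?P k v w) * ?P l w z)"
      unfolding assoc
    proof (rule sum.cong[OF refl])
      fix v assume "v \<in> ?W"
      then show "\<pi> v * (\<Sum>w\<in>?W. ?P l v w * ?P k w z) = \<pi> v * (\<Sum>w\<in>?W. ?P k v w * ?P l w z)"
        using trans_rate_commute[OF _ z kl(3,2) pos] by simp
    qed
    also have "\<dots> = E k * (\<Sum>w\<in>?W. \<pi> w * ?P l w z)"
      unfolding sum_distrib_left by (intro sum.cong refl) (simp add: b)
    finally have 1: "(\<Sum>w\<in>?W. (\<Sum>v\<in>?W. \<pi> v * ?P l v w) * ?P k w z) = E k * (\<Sum>w\<in>?W. \<pi> w * ?P l w z)" .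
    have "(\<Sum>w\<in>?W. E l * \<pi> w * ?P k w z) = E l * (E k * \<pi> z)"
      unfolding b[OF z, symmetric] sum_distrib_left by (simp only: mult.assoc)
    with 1 show "(\<Sum>w\<in>?W. \<mu> w * ?P k w z) = E k * \<mu> z"
      by (simp add: \<mu>_def left_diff_distrib sum_subtractf right_diff_distrib)
  qed
  \<comment> \<open>The sorted word serves as the state that receives mass from everywhere.\<close>
  have "\<mu> w = 0" if "w \<in> ?W" for w
  proof (rule balanced_eq_0[OF _ _ _ _ _ sum0 that])
    show "balanced ?W (?P k) (E k) \<mu>" by (rule bal)
    show "finite ?W" by (rule finite_words_with)
    show "0 \<le> ?P k v w" if "v \<in> ?W" for v w using that pos by (rule trans_rate_nonneg)
    show "(\<Sum>w\<in>?W. ?P k v w) = E k" if "v \<in> ?W" for v using kl(2) that by (rule row)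
    show "0 < \<nu> (sorted_list_of_multiset M)"
      if "balanced ?W (?P k) (E k) \<nu>" "\<And>w. w \<in> ?W \<Longrightarrow> 0 \<le> \<nu> w" "v \<in> ?W" "0 < \<nu> v" for \<nu> v
      using that kl(1,2) pos by (rule sorted_word_pos)
  qed
  then have "balanced ?W (?P l) (E l) \<pi>" by (simp add: balanced_def \<mu>_def)
  then show "stationary n x l ?W \<pi>"
    using st stat[OF kl(3)] by simp
qed

end
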